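(* Let $I$ be a time interval and $I\ni t\mapsto f(\cdot,t)\in\mathcal{O}_{\rm norm}(\overline{\mathbb{D}})$ a smooth evolution whose derivative $g=f'$ is rational of the form $$g(\zeta,t)=b(t)\frac{\prod_{k=1}^m(\zeta-\omega_k(t))}{\prod_{j=1}^n(\zeta-\zeta_j(t))},\qquad m\ge n,\ |\zeta_j(t)|>1,$$ (repetitions allowed among the $\zeta_j$; the $\omega_k$ are the zeros and the $\zeta_j$ the poles of $g$). Assume that $g$ has only simple zeros, and that $g$ and $g^*$ have no common zeros, i.e. $\omega_k\ne\omega_j^*$ for all $k,j$ (in particular $g$ has no zero on $\partial\mathbb{D}$). Let $q(t)$ be real-valued and set $$A_\infty=\lim_{\zeta\to\infty}\frac{q(t)}{g(\zeta,t)g^*(\zeta,t)}=\begin{cases}\dfrac{q\prod_{j=1}^n\bar\zeta_j}{|b|^2\prod_{j=1}^m\bar\omega_j}, & m=n,\\ 0,& m>n,\end{cases}$$ $$A_k=\frac{q(t)}{g'(\omega_k,t)\,g^*(\omega_k,t)}=\frac{q}{|b|^2}\cdot\frac{\prod_j(\omega_k-\zeta_j)\prod_j\overline{(\omega_k^*-\zeta_j)}}{\prod_{j\ne k}(\omega_k-\omega_j)\prod_j\overline{(\omega_k^*-\omega_j)}}\quad(1\le k\le m),$$ $$C=\mathrm{Re}\,A_\infty+\mathrm{Re}\sum_{k=1}^m\frac{A_k}{\omega_k}+\mathrm{i}\,\mathrm{Im}\sum_{k=1}^m\frac{2A_k}{\omega_k}.$$ Suppose $f$ solves the Polubarinova-Galin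 equation, written in the form $$\dot f(\zeta,t)=\zeta f'(\zeta,t)\big(P(\zeta,t)+R(\zeta,t)\big),$$ where $P$ is the (analytically continued) Poisson integral and $$R(\zeta,t)=\mathrm{i}\,\mathrm{Im}\sum_{\omega_j\in\mathbb{D}}\frac{2B_j}{\omega_j}+\sum_{\omega_j\in\mathbb{D}}\Big(\frac{2B_j}{\zeta-\omega_j}-\frac{2\overline{B_j}\,\zeta}{1-\overline{\omega_j}\,\zeta}\Big)\quad\text{with } B_j=A_j \text{ for each } j \text{ with }\omega_j\in\mathbb{D}.$$ Then the zeros, poles and leading coefficient of $g$ satisfy $$\frac{d}{dt}\log\omega_k=-C-\frac{2A_k}{\omega_k}-\sum_{j=1,\,j\ne k}^m\frac{2(A_k+A_j)}{\omega_k-\omega_j}+\sum_{j=1}^n\frac{2A_k}{\omega_k-\zeta_j}$$ $$=P^*(\omega_k)+R^*(\omega_k)-\frac{2A_k}{\omega_k}\Big(1+\sum_{j=1}^m\frac{1}{1-\overline{\omega}_j\omega_k}-\sum_{j=1}^n\frac{1}{1-\overline{\zeta}_j\omega_k}\Big),$$ $$\frac{d}{dt}\log\zeta_j=-C-\sum_{k=1}^m\frac{2A_k}{\zeta_j-\omega_k}=P^*(\zeta_j)+R^*(\zeta_j),$$ $$\frac{d}{dt}\log b=(m-n+1)\,C.$$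
   Context: $\mathbb{D}$ is the open unit disk; $\mathcal{O}_{\rm norm}(\overline{\mathbb{D}})$ is the set of functions $f$ analytic in some neighborhood of $\overline{\mathbb{D}}$ with $f(0)=0$, $f'(0)>0$. Dot denotes $\partial/\partial t$ and prime denotes $\partial/\partial\zeta$. For a point $\omega$, $\omega^*=1/\bar\omega$; for a function $h$, $h^*(\zeta)=\overline{h(1/\bar\zeta)}$. $P(\zeta,t)$ is the analytic function in $\mathbb{D}$ whose real part has boundary values $q(t)/|f'(\zeta,t)|^2$ on $\partial\mathbb{D}$ and which has $\mathrm{Im}\,P(0,t)=0$, i.e. $$P(\zeta,t)=\frac{1}{2\pi\mathrm{i}}\int_{\partial\mathbb{D}}\frac{q(t)}{|f'(z,t)|^2}\frac{z+\zeta}{z-\zeta}\frac{dz}{z}\quad(\zeta\in\mathbb{D});$$ here it extends to a rational function of $\zeta$, also denoted $P$. The Polubarinova-Galin equation is $\mathrm{Re}[\dot f(\zeta,t)\overline{\zeta f'(\zeta,t)}]=q(t)$ for $\zeta\in\partial\mathbb{D}$. "Smooth evolution" means that $f$, and $b,\omega_k,\zeta_j$, depend smoothly on $t$.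
   Formalization: The second expression for ω_k is claimed only if ω_k ≠ ζ_j^* for all j (else 1/(1−ζ̄_jω_k) is undefined); the form P^*(ζ_j)+R^*(ζ_j) is not claimed if ζ_j is a simple pole equal to some ω_k^*, where it fails for q≠0 (e.g. m=n=1). The first expressions are unrestricted. *)

theory Defs
  imports "HOL-Complex_Analysis.Complex_Analysis"
begin

text \<open>\<open>C\<^sup>\<infinity>\<close> on a set of times; at an end point that belongs to the interval the
  derivatives are one-sided.\<close>
definition smooth_in_time :: "real set \<Rightarrow> (real \<Rightarrow> complex) \<Rightarrow> bool" where
  "smooth_in_time I h \<longleftrightarrow>
     (\<exists>D :: nat \<Rightarrow> real \<Rightarrow> complex. D 0 = h \<and>
        (\<forall>n. \<forall>t\<in>I. (D n has_vector_derivative D (Suc n) t) (at t within I)))"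

definition time_deriv :: "real set \<Rightarrow> (real \<Rightarrow> complex) \<Rightarrow> real \<Rightarrow> complex" where
  "time_deriv I h t = vector_derivative h (at t within I)"

text \<open>\<open>d/dt log h\<close>, which does not depend on a branch of the logarithm.\<close>
definition log_time_deriv :: "real set \<Rightarrow> (real \<Rightarrow> complex) \<Rightarrow> real \<Rightarrow> complex" where
  "log_time_deriv I h t = time_deriv I h t / h t"

definition O_norm :: "(complex \<Rightarrow> complex) set" where
  "O_norm = {f. f analytic_on cball 0 1 \<and> f 0 = 0 \<and>
                (\<exists>r::real. r > 0 \<and> deriv f 0 = complex_of_real r)}"

definition circle_refl :: "complex \<Rightarrow> complex" where
  "circle_refl w = 1 / cnj w"

text \<open>The value of \<open>star h\<close> at \<open>0\<close>, where \<open>1 / cnj 0 = 0\<close>, is meaningless.\<close>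
definition star :: "(complex \<Rightarrow> complex) \<Rightarrow> complex \<Rightarrow> complex" where
  "star h \<zeta> = cnj (h (1 / cnj \<zeta>))"

definition rational_g ::
  "nat \<Rightarrow> nat \<Rightarrow> complex \<Rightarrow> (nat \<Rightarrow> complex) \<Rightarrow> (nat \<Rightarrow> complex) \<Rightarrow> complex \<Rightarrow> complex" where
  "rational_g m n b \<omega> z \<zeta> = b * (\<Prod>k=1..m. \<zeta> - \<omega> k) / (\<Prod>j=1..n. \<zeta> - z j)"

definition coef_A_inf :: "real \<Rightarrow> (complex \<Rightarrow> complex) \<Rightarrow> complex" where
  "coef_A_inf q g = Lim at_infinity (\<lambda>\<zeta>. complex_of_real q / (g \<zeta> * star g \<zeta>))"

definition coef_A :: "real \<Rightarrow> (complex \<Rightarrow> complex) \<Rightarrow> complex \<Rightarrow> complex" where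
  "coef_A q g a = complex_of_real q / (deriv g a * star g a)"

definition const_C ::
  "nat \<Rightarrow> complex \<Rightarrow> (nat \<Rightarrow> complex) \<Rightarrow> (nat \<Rightarrow> complex) \<Rightarrow> complex" where
  "const_C m Ainf A \<omega> =
     complex_of_real (Re Ainf) + complex_of_real (Re (\<Sum>k=1..m. A k / \<omega> k))
     + \<i> * complex_of_real (Im (\<Sum>k=1..m. 2 * A k / \<omega> k))"

definition fun_R ::
  "nat \<Rightarrow> (nat \<Rightarrow> complex) \<Rightarrow> (nat \<Rightarrow> complex) \<Rightarrow> complex \<Rightarrow> complex" where
  "fun_R m B \<omega> \<zeta> =
     \<i> * complex_of_real (Im (\<Sum>j | j \<in> {1..m} \<and> \<omega> j \<in> ball 0 1. 2 * B j / \<omega> j))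
     + (\<Sum>j | j \<in> {1..m} \<and> \<omega> j \<in> ball 0 1.
          2 * B j / (\<zeta> - \<omega> j) - 2 * cnj (B j) * \<zeta> / (1 - cnj (\<omega> j) * \<zeta>))"

definition poisson_integral :: "real \<Rightarrow> (complex \<Rightarrow> complex) \<Rightarrow> complex \<Rightarrow> complex" where
  "poisson_integral q f' \<zeta> =
     1 / (2 * complex_of_real pi * \<i>) *
     contour_integral (circlepath 0 1)
       (\<lambda>z. complex_of_real (q / (cmod (f' z))\<^sup>2) * ((z + \<zeta>) / (z - \<zeta>)) / z)"

text \<open>A rational function is given in lowest terms, so that its value is the correct one at every
  point that is not a pole; at a pole it is \<open>0\<close>, by the convention for division by zero.\<close>
definition rational_fun :: "(complex \<Rightarrow> complex) \<Rightarrow> bool" where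
  "rational_fun h \<longleftrightarrow>
     (\<exists>p d :: complex poly. d \<noteq> 0 \<and> coprime p d \<and> (\<forall>\<zeta>. h \<zeta> = poly p \<zeta> / poly d \<zeta>))"

lemma rational_fun_unique:
  assumes "rational_fun h1" "rational_fun h2" "\<And>\<zeta>. \<zeta> \<in> ball 0 1 \<Longrightarrow> h1 \<zeta> = h2 \<zeta>"
  shows "h1 = h2"
proof -
  obtain p1 d1 where 1: "d1 \<noteq> 0" "coprime p1 d1" "\<And>\<zeta>. h1 \<zeta> = poly p1 \<zeta> / poly d1 \<zeta>"
    using assms(1) unfolding rational_fun_def by blast
  obtain p2 d2 where 2: "d2 \<noteq> 0" "coprime p2 d2" "\<And>\<zeta>. h2 \<zeta> = poly p2 \<zeta> / poly d2 \<zeta>"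
    using assms(2) unfolding rational_fun_def by blast
  have np: "poly p \<zeta> \<noteq> 0" if "coprime p d" "poly d \<zeta> = 0" for p d :: "complex poly" and \<zeta>
    using that coprime_poly_0 by blast
  define r where "r = (p1 * d2 - p2 * d1) * (d1 * d2)"
  have "poly r \<zeta> = 0" if "\<zeta> \<in> ball 0 1" for \<zeta>
    using assms(3)[OF that] 1(3)[of \<zeta>] 2(3)[of \<zeta>]
    by (cases "poly d1 \<zeta> = 0"; cases "poly d2 \<zeta> = 0") (auto simp: r_def field_simps)
  then have "ball 0 1 \<subseteq> {\<zeta>. poly r \<zeta> = 0}" by auto
  moreover have "infinite (ball (0::complex) 1)"
    by (simp add: uncountable_ball uncountable_infinite)
  ultimately have "r = 0"
    using poly_roots_finite[of r] finite_subset by blast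
  then have eq: "p1 * d2 = p2 * d1"
    using 1(1) 2(1) by (simp add: r_def)
  have eq': "poly p1 \<zeta> * poly d2 \<zeta> = poly p2 \<zeta> * poly d1 \<zeta>" for \<zeta>
    using arg_cong[OF eq, of "\<lambda>p. poly p \<zeta>"] by simp
  show ?thesis
  proof
    fix \<zeta>
    show "h1 \<zeta> = h2 \<zeta>"
      using eq'[of \<zeta>] np[OF 1(2), of \<zeta>] np[OF 2(2), of \<zeta>] 1(3)[of \<zeta>] 2(3)[of \<zeta>]
      by (cases "poly d1 \<zeta> = 0"; cases "poly d2 \<zeta> = 0") (auto simp: frac_eq_eq)
  qed
qed

text \<open>The analytic continuation of the Poisson integral from the disk to a rational function;
  by \<open>rational_fun_unique\<close> there is at most one.\<close>
definition poisson_cont :: "real \<Rightarrow> (complex \<Rightarrow> complex) \<Rightarrow> complex \<Rightarrow> complex" where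
  "poisson_cont q f' =
     (THE P. rational_fun P \<and> (\<forall>\<zeta>\<in>ball 0 1. P \<zeta> = poisson_integral q f' \<zeta>))"

definition polubarinova_galin ::
  "real set \<Rightarrow> (real \<Rightarrow> complex \<Rightarrow> complex) \<Rightarrow> (real \<Rightarrow> real) \<Rightarrow> bool" where
  "polubarinova_galin I f q \<longleftrightarrow>
     (\<forall>t\<in>I. \<forall>\<zeta>\<in>sphere 0 1.
        Re (time_deriv I (\<lambda>s. f s \<zeta>) t * cnj (\<zeta> * deriv (f t) \<zeta>)) = q t)"

end

theory Submission
  imports Defs
begin

text \<open>
  Fix \<open>t\<close>. The function \<open>h = q / (g g\<^sup>*)\<close> is rational, is invariant under the reflection in the circle, and has
  only the simple poles \<open>\<omega>\<^sub>k\<close> and \<open>\<omega>\<^sub>k\<^sup>*\<close>, with residues determined by \<open>A\<^sub>k\<close>; its value at \<open>\<infinity>\<close> fixes the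
  remaining constant. On the circle \<open>h\<close> is therefore the real part of \<open>Q = C + \<Sum>\<^sub>k 2 A\<^sub>k / (\<zeta> - \<omega>\<^sub>k)\<close>, and
  \<open>Q + Q\<^sup>* = 2 h\<close> everywhere. Moving the poles of \<open>Q\<close> in the disk to their reflections gives a function
  with the same real part that is analytic in the disk. By the Schwarz integral formula it is \<open>P\<close> up to
  an imaginary constant, and \<open>R\<close> moves the poles back: \<open>P + R = Q\<close>.

  Differentiating \<open>f = \<integral> g\<close> in time under the integral sign, the evolution equation becomes
  \<open>\<partial>\<^sub>t g = (\<zeta> g Q)'\<close>. Divided by \<open>g\<close> this is an identity between rational functions of \<open>\<zeta>\<close>, and the
  velocities are read off from the residues at \<open>\<omega>\<^sub>k\<close> and \<open>\<zeta>\<^sub>j\<close> and from the value at \<open>\<infinity>\<close>. The forms with \<open>P\<^sup>* + R\<^sup>*\<close>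
  follow from \<open>Q + Q\<^sup>* = 2 h\<close>.
\<close>

section \<open>Rational functions, residues and the Schwarz integral formula\<close>

text \<open>The poles \<open>z j\<close> may be repeated and may collide or separate as
  \<open>t\<close> varies. Where several coincide, a residue gives only the sum of their velocities.
  The single velocities are recovered by a limit in time, which requires \<open>q\<close>,
  \<open>A k\<close> and \<open>C\<close> to be continuous on \<open>I\<close>; for
  \<open>q\<close>, about which nothing is assumed, continuity is read off from the boundary
  equation at one point of the circle.

  The constant \<open>C\<close> has two sources. Its real part is what remains of the constant in
  the expansion of \<open>h\<close> once the terms at the reflected zeros are normalised to vanish
  at 0. Its imaginary part is the one for which \<open>Q\<close> is real at 0, because both
  \<open>P\<close> and \<open>R\<close> are real there.

  The condition \<open>n \<le> m\<close> keeps \<open>h\<close> finite at infinity, and by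
  reflection bounded near 0.

  The relation between \<open>Q\<close> and its reflection is used at points where it degenerates:
  at \<open>\<omega> k\<close> only the constant Laurent coefficients can be compared, and at
  \<open>z j\<close> the value of \<open>h\<close> is 0 unless a zero of \<open>star g\<close>
  interferes. These coincidences are the origin of the side conditions on the second form of the
  velocities.\<close>

lemma poly_quotient_lowest_terms:
  fixes p d :: "complex poly"
  assumes "d \<noteq> 0"
  obtains p' d' c where "coprime p' d'" "p = p' * c" "d = d' * c"
proof -
  have "\<exists>p' d' c. coprime p' d' \<and> p = p' * c \<and> d = d' * c"
    using assms
  proof (induction "degree d" arbitrary: p d rule: less_induct)
    case less
    show ?case
    proof (cases "coprime p d")
      case True
      then show ?thesis by (intro exI[of _ p] exI[of _ d] exI[of _ 1]) simp
    next
      case False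
      then obtain e where e: "e dvd p" "e dvd d" "\<not> e dvd 1"
        unfolding coprime_def by blast
      then obtain p1 d1 where 1: "p = e * p1" "d = e * d1" by (auto elim!: dvdE)
      have nz: "e \<noteq> 0" "d1 \<noteq> 0" using 1 less.prems by auto
      have "degree e \<noteq> 0" using e(3) nz(1) by (auto simp: is_unit_iff_degree)
      then have "degree d1 < degree d" using nz by (simp add: 1 degree_mult_eq)
      then obtain p' d' c where "coprime p' d'" "p1 = p' * c" "d1 = d' * c"
        using less.hyps nz(2) by blast
      then show ?thesis
        by (intro exI[of _ p'] exI[of _ d'] exI[of _ "c * e"]) (simp add: 1 ac_simps)
    qed
  qed
  then show ?thesis using that by blast
qed

text \<open>At a common root of \<open>p\<close> and \<open>d\<close> the plain quotient has the
  default value 0, whereas \<open>rational_fun\<close> demands the value of the reduced fraction.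
  Agreement can therefore be claimed only off the roots of \<open>d\<close>.\<close>

lemma rational_fun_of_quotient:
  fixes p d :: "complex poly"
  assumes "d \<noteq> 0"
  obtains h where "rational_fun h" "\<And>\<zeta>. poly d \<zeta> \<noteq> 0 \<Longrightarrow> h \<zeta> = poly p \<zeta> / poly d \<zeta>"
proof -
  obtain p' d' c where pd: "coprime p' d'" "p = p' * c" "d = d' * c"
    using poly_quotient_lowest_terms assms by blast
  have "d' \<noteq> 0" using pd assms by auto
  show ?thesis
  proof
    show "rational_fun (\<lambda>\<zeta>. poly p' \<zeta> / poly d' \<zeta>)"
      unfolding rational_fun_def using \<open>d' \<noteq> 0\<close> pd(1) by blast
  qed (auto simp: pd)
qed

text \<open>The exceptional set \<open>T\<close> makes the notion stable under sums, with no
  cancellation of common factors along the way; the reduction to lowest terms happens once, at the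
  end.\<close>

definition rational_off :: "complex set \<Rightarrow> (complex \<Rightarrow> complex) \<Rightarrow> bool" where
  "rational_off T h \<longleftrightarrow> (\<exists>p d :: complex poly. d \<noteq> 0 \<and>
     (\<forall>\<zeta>. \<zeta> \<notin> T \<longrightarrow> poly d \<zeta> \<noteq> 0 \<and> h \<zeta> = poly p \<zeta> / poly d \<zeta>))"

lemma rational_off_const: "rational_off T (\<lambda>_. c)"
  unfolding rational_off_def by (rule exI[of _ "[:c:]"], rule exI[of _ 1]) auto

lemma rational_off_add:
  assumes "rational_off T h1" "rational_off T h2"
  shows "rational_off T (\<lambda>\<zeta>. h1 \<zeta> + h2 \<zeta>)"
proof -
  obtain p1 d1 where 1: "d1 \<noteq> 0" "\<And>\<zeta>. \<zeta> \<notin> T \<Longrightarrow> poly d1 \<zeta> \<noteq> 0 \<and> h1 \<zeta> = poly p1 \<zeta> / poly d1 \<zeta>"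
    using assms(1) unfolding rational_off_def by blast
  obtain p2 d2 where 2: "d2 \<noteq> 0" "\<And>\<zeta>. \<zeta> \<notin> T \<Longrightarrow> poly d2 \<zeta> \<noteq> 0 \<and> h2 \<zeta> = poly p2 \<zeta> / poly d2 \<zeta>"
    using assms(2) unfolding rational_off_def by blast
  show ?thesis
    unfolding rational_off_def
    by (rule exI[of _ "p1 * d2 + p2 * d1"], rule exI[of _ "d1 * d2"])
      (use 1 2 in \<open>auto simp: add_frac_eq\<close>)
qed

lemma rational_off_sum:
  assumes "\<And>i. i \<in> S \<Longrightarrow> rational_off T (h i)"
  shows "rational_off T (\<lambda>\<zeta>. \<Sum>i\<in>S. h i \<zeta>)"
  using assms
  by (induction S rule: infinite_finite_induct) (auto intro: rational_off_const rational_off_add)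

lemma rational_off_mobius:
  assumes "(c, d) \<noteq> (0, 0)" "\<And>\<zeta>. c * \<zeta> + d = 0 \<Longrightarrow> \<zeta> \<in> T"
  shows "rational_off T (\<lambda>\<zeta>. (a * \<zeta> + b) / (c * \<zeta> + d))"
  unfolding rational_off_def
  by (rule exI[of _ "[:b, a:]"], rule exI[of _ "[:d, c:]"])
    (use assms in \<open>auto simp: algebra_simps\<close>)

lemma rational_off_imp_rational_fun:
  assumes "rational_off T h"
  shows "\<exists>h'. rational_fun h' \<and> (\<forall>\<zeta>. \<zeta> \<notin> T \<longrightarrow> h' \<zeta> = h \<zeta>)"
  using assms rational_fun_of_quotient unfolding rational_off_def by metis

text \<open>Induction on \<open>S\<close>: dividing \<open>p\<close> by \<open>x - s\<close> leaves
  the remainder \<open>poly p s\<close>, and each product of two simple fractions with distinct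
  poles \<open>a\<close> and \<open>s\<close> splits into a difference. Equality of
  \<open>degree p\<close> and \<open>card S\<close> is allowed, which is why a constant
  \<open>\<kappa>\<close> appears.\<close>

lemma partial_fractions:
  fixes p :: "complex poly"
  assumes "finite S" "degree p \<le> card S"
  obtains \<kappa> r where "\<And>x. x \<notin> S \<Longrightarrow> poly p x / (\<Prod>a\<in>S. x - a) = \<kappa> + (\<Sum>a\<in>S. r a / (x - a))"
proof -
  have "\<exists>\<kappa> r. \<forall>x. x \<notin> S \<longrightarrow> poly p x / (\<Prod>a\<in>S. x - a) = \<kappa> + (\<Sum>a\<in>S. r a / (x - a))"
    using assms
  proof (induction S arbitrary: p rule: finite_induct)
    case empty
    then obtain c where "p = [:c:]" by (auto elim: degree_eq_zeroE)
    then show ?case by auto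
  next
    case (insert s S)
    define p1 where "p1 = synthetic_div p s"
    have p: "poly p x = (x - s) * poly p1 x + poly p s" for x
      using arg_cong[OF synthetic_div_correct'[of s p], of "\<lambda>p. poly p x"]
      by (simp add: p1_def algebra_simps)
    have "degree p1 \<le> card S"
      using insert by (simp add: p1_def degree_synthetic_div)
    then obtain \<kappa>1 r1 where 1: "\<And>x. x \<notin> S \<Longrightarrow>
        poly p1 x / (\<Prod>a\<in>S. x - a) = \<kappa>1 + (\<Sum>a\<in>S. r1 a / (x - a))"
      using insert.IH by blast
    \<comment> \<open>For empty \<open>S\<close> the constant \<open>\<kappa>2\<close> is the whole
      remainder. It is therefore carried along and becomes part of the residue at
      \<open>s\<close>.\<close>
    obtain \<kappa>2 r2 where 2: "\<And>x. x \<notin> S \<Longrightarrow>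
        poly [:poly p s:] x / (\<Prod>a\<in>S. x - a) = \<kappa>2 + (\<Sum>a\<in>S. r2 a / (x - a))"
      using insert.IH[of "[:poly p s:]"] by auto
    define r where "r = (\<lambda>a. if a = s then \<kappa>2 - (\<Sum>a\<in>S. r2 a / (a - s)) else r1 a + r2 a / (a - s))"
    have "poly p x / (\<Prod>a\<in>insert s S. x - a) = \<kappa>1 + (\<Sum>a\<in>insert s S. r a / (x - a))"
      if x: "x \<notin> insert s S" for x
    proof -
      have nz: "x - s \<noteq> 0" "(\<Prod>a\<in>S. x - a) \<noteq> 0" using x insert.hyps by auto
      have "poly p x / (\<Prod>a\<in>insert s S. x - a) =
          poly p1 x / (\<Prod>a\<in>S. x - a) + poly [:poly p s:] x / (\<Prod>a\<in>S. x - a) / (x - s)"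
        using nz insert.hyps by (simp add: p[of x] field_simps)
      also have "\<dots> = \<kappa>1 + (\<Sum>a\<in>S. r1 a / (x - a)) + \<kappa>2 / (x - s)
          + (\<Sum>a\<in>S. r2 a / (x - a) / (x - s))"
        using 1[of x] 2[of x] x by (simp add: add_divide_distrib sum_divide_distrib)
      also have "(\<Sum>a\<in>S. r2 a / (x - a) / (x - s)) =
          (\<Sum>a\<in>S. r2 a / (a - s) / (x - a) - r2 a / (a - s) / (x - s))"
      proof (rule sum.cong)
        fix a assume "a \<in> S"
        then have "a \<noteq> s" "x \<noteq> a" "x \<noteq> s" using insert.hyps x by auto
        then show "r2 a / (x - a) / (x - s) = r2 a / (a - s) / (x - a) - r2 a / (a - s) / (x - s)"
          by (simp add: divide_simps) (simp add: algebra_simps)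
      qed simp
      also have "\<dots> = (\<Sum>a\<in>S. r2 a / (a - s) / (x - a)) - (\<Sum>a\<in>S. r2 a / (a - s)) / (x - s)"
        by (simp add: sum_subtractf sum_divide_distrib)
      also have "\<kappa>1 + (\<Sum>a\<in>S. r1 a / (x - a)) + \<kappa>2 / (x - s) + \<dots> =
          \<kappa>1 + (r s / (x - s) + (\<Sum>a\<in>S. (r1 a + r2 a / (a - s)) / (x - a)))"
        by (simp add: r_def add_divide_distrib diff_divide_distrib sum.distrib)
      also have "(\<Sum>a\<in>S. (r1 a + r2 a / (a - s)) / (x - a)) = (\<Sum>a\<in>S. r a / (x - a))"
        using insert.hyps by (intro sum.cong) (auto simp: r_def)
      finally show ?thesis using insert.hyps by simp
    qed
    then show ?case by blast
  qed
  then show ?thesis using that by blast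
qed

text \<open>The \<open>a i\<close> may coincide, so the limit collects all coefficients that sit at
  \<open>x\<close>. For the poles of \<open>g\<close> this is how sums of velocities arise.\<close>

lemma tendsto_sum_simple_poles:
  fixes a :: "'i \<Rightarrow> complex"
  assumes "finite S"
  shows "((\<lambda>\<zeta>. (\<zeta> - x) * (\<Sum>i\<in>S. c i / (\<zeta> - a i))) \<longlongrightarrow> (\<Sum>i | i \<in> S \<and> a i = x. c i)) (at x)"
proof -
  have "((\<lambda>\<zeta>. (\<zeta> - x) * (c i / (\<zeta> - a i))) \<longlongrightarrow> (if a i = x then c i else 0)) (at x)" for i
  proof (cases "a i = x")
    case True
    have "((\<lambda>\<zeta>. (\<zeta> - x) * (c i / (\<zeta> - a i))) \<longlongrightarrow> c i) (at x)"
      by (rule Lim_transform_eventually[OF tendsto_const])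
        (auto simp: True eventually_at_filter)
    then show ?thesis using True by simp
  next
    case False
    then show ?thesis by (auto intro!: tendsto_eq_intros)
  qed
  then have "((\<lambda>\<zeta>. \<Sum>i\<in>S. (\<zeta> - x) * (c i / (\<zeta> - a i))) \<longlongrightarrow>
      (\<Sum>i\<in>S. if a i = x then c i else 0)) (at x)"
    by (intro tendsto_sum)
  then show ?thesis
    using assms by (simp add: sum_distrib_left sum.If_cases Int_def)
qed

lemma eventually_at_avoids_finite:
  fixes a :: "'a :: t1_space"
  assumes "finite S"
  shows "\<forall>\<^sub>F x in at a. x \<notin> S"
proof -
  have "\<forall>\<^sub>F x in at a. x \<in> - (S - {a}) - {a}"
    using assms by (intro eventually_at_in_open open_Compl finite_imp_closed) auto
  then show ?thesis by eventually_elim auto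
qed

lemma tendsto_inverse_shift_infinity:
  fixes a :: complex
  shows "((\<lambda>\<zeta>. c / (\<zeta> - a)) \<longlongrightarrow> 0) at_infinity"
proof -
  have "filterlim (\<lambda>\<zeta>::complex. \<zeta> - a) at_infinity at_infinity"
    using tendsto_add_filterlim_at_infinity'[OF filterlim_ident tendsto_const, of "-a"] by simp
  then show ?thesis
    by (intro tendsto_divide_0[OF tendsto_const])
qed

lemma tendsto_ratio_infinity:
  fixes a :: complex
  shows "((\<lambda>\<zeta>. \<zeta> / (\<zeta> - a)) \<longlongrightarrow> 1) at_infinity"
proof -
  have "((\<lambda>\<zeta>. 1 + a / (\<zeta> - a)) \<longlongrightarrow> 1 + 0) at_infinity"
    by (intro tendsto_intros tendsto_inverse_shift_infinity)
  moreover have "\<forall>\<^sub>F \<zeta> in at_infinity. 1 + a / (\<zeta> - a) = \<zeta> / (\<zeta> - a)"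
    using eventually_not_equal_at_infinity[of a]
    by eventually_elim (simp add: field_simps)
  ultimately show ?thesis by (simp add: Lim_transform_eventually)
qed

text \<open>On the unit circle \<open>dz / z\<close> is a constant multiple of the real arc-length
  element, so the integral is a mean value over a real parameter, and this commutes with
  conjugation.\<close>

lemma contour_integral_circle_cnj:
  assumes "((\<lambda>z. h z / z) has_contour_integral (2 * of_real pi * \<i> * c)) (circlepath 0 1)"
  shows "((\<lambda>z. cnj (h z) / z) has_contour_integral (2 * of_real pi * \<i> * cnj c)) (circlepath 0 1)"
proof -
  let ?e = "\<lambda>s::real. exp (2 * of_real pi * \<i> * of_real s)"
  have eq: "((\<lambda>z. h z / z) has_contour_integral (2 * of_real pi * \<i> * c)) (circlepath 0 1)
     \<longleftrightarrow> ((\<lambda>s. h (?e s)) has_integral c) {0..1}" (is "?l h c \<longleftrightarrow> _") for h :: "complex \<Rightarrow> complex" and c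
  proof -
    have "?l h c \<longleftrightarrow> ((\<lambda>s. 2 * of_real pi * \<i> * h (?e s)) has_integral (2 * of_real pi * \<i> * c)) {0..1}"
      unfolding has_contour_integral_def
    proof (intro has_integral_cong)
      fix s :: real assume "s \<in> {0..1}"
      then show "h (circlepath 0 1 s) / circlepath 0 1 s *
          vector_derivative (circlepath 0 1) (at s within {0..1}) = 2 * of_real pi * \<i> * h (?e s)"
        by (simp add: vector_derivative_circlepath01) (simp add: circlepath)
    qed
    also have "\<dots> \<longleftrightarrow> ((\<lambda>s. h (?e s)) has_integral c) {0..1}"
      by (subst has_integral_mult_right_iff) auto
    finally show ?thesis .
  qed
  show ?thesis
    using assms unfolding eq using has_integral_cnj[of "\<lambda>s. h (?e s)" c "{0..1}"]
    by (simp add: o_def)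
qed

text \<open>Write \<open>u\<close> as half of \<open>F + cnj F\<close>. For the first summand the
  kernel splits into \<open>2 / (z - \<zeta>) - 1 / z\<close> and Cauchy's formula applies. On the
  circle the kernel \<open>(z + \<zeta>) / (z - \<zeta>)\<close> is the conjugate of
  \<open>(1 + cnj \<zeta> * z) / (1 - cnj \<zeta> * z)\<close>, so the second summand is the
  conjugate of a function \<open>H\<close> holomorphic on the closed disk, with
  \<open>H 0 = F 0\<close>.\<close>

lemma schwarz_integral_formula:
  assumes F: "F holomorphic_on cball 0 1" and \<zeta>: "norm \<zeta> < 1"
    and u: "\<And>z. norm z = 1 \<Longrightarrow> u z = Re (F z)"
  shows "contour_integral (circlepath 0 1) (\<lambda>z. of_real (u z) * ((z + \<zeta>) / (z - \<zeta>)) / z) =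
    2 * of_real pi * \<i> * (F \<zeta> - \<i> * of_real (Im (F 0)))"
proof -
  have 1: "((\<lambda>z. F z / (z - \<zeta>)) has_contour_integral (2 * of_real pi * \<i> * F \<zeta>)) (circlepath 0 1)"
    using Cauchy_integral_circlepath_simple[OF F] \<zeta> by simp
  have 2: "((\<lambda>z. F z / z) has_contour_integral (2 * of_real pi * \<i> * F 0)) (circlepath 0 1)"
    using Cauchy_integral_circlepath_simple[OF F, of 0] by simp
  define H where "H = (\<lambda>z. F z * ((1 + cnj \<zeta> * z) / (1 - cnj \<zeta> * z)))"
  have "1 - cnj \<zeta> * z \<noteq> 0" if "z \<in> cball 0 1" for z
  proof
    assume "1 - cnj \<zeta> * z = 0"
    then have "norm \<zeta> * norm z = 1"
      by (metis complex_mod_cnj eq_iff_diff_eq_0 norm_mult norm_one)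
    moreover have "norm \<zeta> * norm z \<le> norm \<zeta> * 1"
      using that by (intro mult_left_mono) auto
    ultimately show False using \<zeta> by simp
  qed
  then have "H holomorphic_on cball 0 1"
    unfolding H_def by (intro holomorphic_intros F) auto
  then have "((\<lambda>z. H z / z) has_contour_integral (2 * of_real pi * \<i> * F 0)) (circlepath 0 1)"
    using Cauchy_integral_circlepath_simple[of H 0 1 0] by (simp add: H_def)
  then have 3: "((\<lambda>z. cnj (H z) / z) has_contour_integral (2 * of_real pi * \<i> * cnj (F 0))) (circlepath 0 1)"
    by (rule contour_integral_circle_cnj)
  have "((\<lambda>z. (2 * (F z / (z - \<zeta>)) - F z / z + cnj (H z) / z) / 2) has_contour_integral
      (2 * (2 * of_real pi * \<i> * F \<zeta>) - 2 * of_real pi * \<i> * F 0 + 2 * of_real pi * \<i> * cnj (F 0)) / 2)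
      (circlepath 0 1)"
    by (intro has_contour_integral_div has_contour_integral_add has_contour_integral_diff
        has_contour_integral_lmul 1 2 3)
  then have "((\<lambda>z. of_real (u z) * ((z + \<zeta>) / (z - \<zeta>)) / z) has_contour_integral
      (2 * (2 * of_real pi * \<i> * F \<zeta>) - 2 * of_real pi * \<i> * F 0 + 2 * of_real pi * \<i> * cnj (F 0)) / 2)
      (circlepath 0 1)"
  proof (rule has_contour_integral_eq)
    fix z assume "z \<in> path_image (circlepath (0::complex) 1)"
    then have z: "norm z = 1" by simp
    then have nz: "z \<noteq> 0" "z \<noteq> \<zeta>" using \<zeta> by auto
    have cz: "cnj z = 1 / z"
      using z nz by (metis complex_div_cnj divide_self_if mult_1 of_real_1 one_power2 times_divide_eq_left)
    have "cnj (H z) = cnj (F z) * ((z + \<zeta>) / (z - \<zeta>))"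
      using nz by (simp add: H_def cz field_simps)
    moreover have "of_real (u z) = (F z + cnj (F z)) / 2"
      by (simp add: u[OF z] complex_add_cnj)
    moreover have "2 / (z - \<zeta>) - 1 / z = (z + \<zeta>) / (z - \<zeta>) / z"
      using nz by (simp add: field_simps)
    then have "2 * (F z / (z - \<zeta>)) - F z / z = F z * ((z + \<zeta>) / (z - \<zeta>)) / z"
      by (metis (no_types, lifting) mult.commute mult.right_neutral right_diff_distrib times_divide_eq_right)
    ultimately show "(2 * (F z / (z - \<zeta>)) - F z / z + cnj (H z) / z) / 2 =
        of_real (u z) * ((z + \<zeta>) / (z - \<zeta>)) / z"
      by (simp add: add_divide_distrib algebra_simps)
  qed
  then have "contour_integral (circlepath 0 1) (\<lambda>z. of_real (u z) * ((z + \<zeta>) / (z - \<zeta>)) / z) =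
     (2 * (2 * of_real pi * \<i> * F \<zeta>) - 2 * of_real pi * \<i> * F 0 + 2 * of_real pi * \<i> * cnj (F 0)) / 2"
    by (rule contour_integral_unique)
  also have "\<dots> = 2 * of_real pi * \<i> * (F \<zeta> - (F 0 - cnj (F 0)) / 2)"
    by (simp add: field_simps)
  also have "(F 0 - cnj (F 0)) / 2 = \<i> * of_real (Im (F 0))"
    by (simp add: complex_diff_cnj)
  finally show ?thesis .
qed

section \<open>The coefficients at a fixed time\<close>

text \<open>The data at one instant. In the application \<open>b_nz\<close> and
  \<open>zero_nz\<close> come from the normalisation of \<open>f\<close> at 0. The case
  \<open>k = j\<close> of \<open>zero_neq_refl\<close> keeps the zeros off the circle; the
  \<open>z j\<close> may coincide.\<close>

locale zero_pole_data =
  fixes m n :: nat and b :: complex and \<omega> z :: "nat \<Rightarrow> complex" and q :: real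
  assumes n_le_m: "n \<le> m"
    and b_nz: "b \<noteq> 0"
    and zero_nz: "\<And>k. k \<in> {1..m} \<Longrightarrow> \<omega> k \<noteq> 0"
    and pole_outside: "\<And>j. j \<in> {1..n} \<Longrightarrow> cmod (z j) > 1"
    and zero_neq_pole: "\<And>k j. k \<in> {1..m} \<Longrightarrow> j \<in> {1..n} \<Longrightarrow> \<omega> k \<noteq> z j"
    and inj_zero: "inj_on \<omega> {1..m}"
    and zero_neq_refl: "\<And>k j. k \<in> {1..m} \<Longrightarrow> j \<in> {1..m} \<Longrightarrow> \<omega> k \<noteq> circle_refl (\<omega> j)"
begin

abbreviation g :: "complex \<Rightarrow> complex" where "g \<equiv> rational_g m n b \<omega> z"
abbreviation A :: "nat \<Rightarrow> complex" where "A k \<equiv> coef_A q g (\<omega> k)"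
abbreviation Ainf :: complex where "Ainf \<equiv> coef_A_inf q g"
abbreviation C :: complex where "C \<equiv> const_C m Ainf A \<omega>"

definition h :: "complex \<Rightarrow> complex" where
  "h \<zeta> = of_real q / (g \<zeta> * star g \<zeta>)"

definition Q :: "complex \<Rightarrow> complex" where
  "Q \<zeta> = C + (\<Sum>k=1..m. 2 * A k / (\<zeta> - \<omega> k))"

text \<open>This is \<open>(\<zeta> - \<omega> k) * h \<zeta>\<close> with the singular factor
  cancelled. It is regular at \<open>\<omega> k\<close>: its value there is the residue of
  \<open>h\<close>, and its derivative there is the next Laurent coefficient. The poles of
  \<open>g\<close> enter only through the numerator, so the formula stays correct when
  \<open>\<omega> k\<close> is the reflection of a pole.\<close>

definition H :: "nat \<Rightarrow> complex \<Rightarrow> complex" where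
  "H k \<zeta> = of_real (q / (cmod b)\<^sup>2) *
     (((\<Prod>j=1..n. \<zeta> - z j) * (\<Prod>j=1..n. 1 / \<zeta> - cnj (z j)))
      / ((\<Prod>j\<in>{1..m} - {k}. \<zeta> - \<omega> j) * (\<Prod>j=1..m. 1 / \<zeta> - cnj (\<omega> j))))"

lemma norm_zero_neq_1:
  assumes "k \<in> {1..m}"
  shows "cmod (\<omega> k) \<noteq> 1"
proof
  assume "cmod (\<omega> k) = 1"
  then have "\<omega> k * cnj (\<omega> k) = 1"
    by (simp add: complex_norm_square[symmetric])
  then have "\<omega> k = circle_refl (\<omega> k)"
    using zero_nz[OF assms] by (simp add: circle_refl_def field_simps)
  then show False using zero_neq_refl[OF assms assms] by simp
qed

lemma zero_eq_iff: "k \<in> {1..m} \<Longrightarrow> j \<in> {1..m} \<Longrightarrow> \<omega> k = \<omega> j \<longleftrightarrow> k = j"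
  using inj_zero by (auto dest: inj_onD)

lemma pole_nz: "j \<in> {1..n} \<Longrightarrow> z j \<noteq> 0"
  using pole_outside[of j] by auto

lemma refl_denom_eq_0_iff:
  assumes "k \<in> {1..m}"
  shows "1 - cnj (\<omega> k) * \<zeta> = 0 \<longleftrightarrow> \<zeta> = circle_refl (\<omega> k)"
  using zero_nz[OF assms] by (auto simp: circle_refl_def field_simps)

lemma inverse_minus_cnj_zero_nz:
  assumes "k \<in> {1..m}" "j \<in> {1..m}"
  shows "1 / \<omega> k - cnj (\<omega> j) \<noteq> 0"
  using zero_neq_refl[OF assms] zero_nz[OF assms(1)] zero_nz[OF assms(2)]
  by (auto simp: circle_refl_def field_simps)

lemma star_g: "star g \<zeta> = cnj b * (\<Prod>k=1..m. 1 / \<zeta> - cnj (\<omega> k)) / (\<Prod>j=1..n. 1 / \<zeta> - cnj (z j))"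
  by (simp add: star_def rational_g_def)

lemma h_eq: "h \<zeta> = of_real (q / (cmod b)\<^sup>2) *
     (((\<Prod>j=1..n. \<zeta> - z j) * (\<Prod>j=1..n. 1 / \<zeta> - cnj (z j)))
      / ((\<Prod>j=1..m. \<zeta> - \<omega> j) * (\<Prod>j=1..m. 1 / \<zeta> - cnj (\<omega> j))))"
  unfolding h_def star_g rational_g_def of_real_divide complex_norm_square by simp

lemma h_mult_linear:
  assumes "k \<in> {1..m}" "\<zeta> \<noteq> \<omega> k"
  shows "(\<zeta> - \<omega> k) * h \<zeta> = H k \<zeta>"
proof -
  have "(\<Prod>j=1..m. \<zeta> - \<omega> j) = (\<zeta> - \<omega> k) * (\<Prod>j\<in>{1..m} - {k}. \<zeta> - \<omega> j)"
    using assms by (subst prod.remove[of _ k]) auto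
  then show ?thesis
    using assms(2) by (simp add: h_eq H_def)
qed

lemma h_reflect: "h (1 / cnj \<zeta>) = cnj (h \<zeta>)"
  by (simp add: h_def star_def)

text \<open>Since \<open>g\<close> vanishes at \<open>\<omega> k\<close>, the cofactor of
  \<open>\<zeta> - \<omega> k\<close> is a continuous difference quotient, as in Caratheodory's
  criterion.\<close>

lemma deriv_g:
  assumes k: "k \<in> {1..m}"
  shows "deriv g (\<omega> k) = b * (\<Prod>j\<in>{1..m} - {k}. \<omega> k - \<omega> j) / (\<Prod>j=1..n. \<omega> k - z j)"
proof -
  let ?G = "\<lambda>\<zeta>. b * (\<Prod>j\<in>{1..m} - {k}. \<zeta> - \<omega> j) / (\<Prod>j=1..n. \<zeta> - z j)"
  have g: "g \<zeta> = ?G \<zeta> * (\<zeta> - \<omega> k)" for \<zeta>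
  proof -
    have "(\<Prod>j=1..m. \<zeta> - \<omega> j) = (\<zeta> - \<omega> k) * (\<Prod>j\<in>{1..m} - {k}. \<zeta> - \<omega> j)"
      using k by (subst prod.remove[of _ k]) auto
    then show ?thesis by (simp add: rational_g_def)
  qed
  have "isCont ?G (\<omega> k)"
    using zero_neq_pole[OF k] by (intro continuous_intros) auto
  moreover have "\<forall>\<zeta>. g \<zeta> - g (\<omega> k) = ?G \<zeta> * (\<zeta> - \<omega> k)"
    using g by (auto simp: g[of "\<omega> k"])
  ultimately have "(g has_field_derivative ?G (\<omega> k)) (at (\<omega> k))"
    unfolding CARAT_DERIV by (intro exI[of _ ?G]) blast
  then show ?thesis by (rule DERIV_imp_deriv)
qed

text \<open>If \<open>\<omega> k\<close> is the reflection of a pole, then \<open>star g (\<omega> k)\<close> has the junk value \<open>0\<close>, and so \<open>A k = 0\<close>, which is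
  the residue of \<open>h\<close> at this point.\<close>
lemma A_eq_H: "k \<in> {1..m} \<Longrightarrow> A k = H k (\<omega> k)"
  unfolding coef_A_def deriv_g star_g H_def of_real_divide complex_norm_square by simp

lemma A_eq:
  assumes "k \<in> {1..m}"
  shows "A k = of_real (q / (cmod b)\<^sup>2) *
     (((\<Prod>j=1..n. \<omega> k - z j) * (\<Prod>j=1..n. cnj (circle_refl (\<omega> k) - z j)))
      / ((\<Prod>j\<in>{1..m} - {k}. \<omega> k - \<omega> j) * (\<Prod>j=1..m. cnj (circle_refl (\<omega> k) - \<omega> j))))"
  unfolding A_eq_H[OF assms] H_def by (simp add: circle_refl_def)

text \<open>The bracket is the logarithmic derivative of \<open>H k\<close>. A factor
  \<open>1 / \<zeta> - cnj a\<close> contributes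
  \<open>- 1 / (\<zeta> * (1 - cnj a * \<zeta>))\<close>, which explains the sums divided by
  \<open>\<omega> k\<close>. The hypothesis \<open>nz\<close> keeps every factor different from
  0.\<close>

lemma H_has_derivative:
  assumes k: "k \<in> {1..m}" and nz: "\<And>j. j \<in> {1..n} \<Longrightarrow> \<omega> k \<noteq> circle_refl (z j)"
  shows "(H k has_field_derivative A k *
     ((\<Sum>j=1..n. 1 / (\<omega> k - z j)) - (\<Sum>j=1..n. 1 / (1 - cnj (z j) * \<omega> k)) / \<omega> k
      - (\<Sum>j\<in>{1..m}-{k}. 1 / (\<omega> k - \<omega> j)) + (\<Sum>j=1..m. 1 / (1 - cnj (\<omega> j) * \<omega> k)) / \<omega> k))
     (at (\<omega> k))"
proof -
  have lin: "((\<lambda>\<zeta>. \<Prod>j\<in>S. \<zeta> - a j) has_field_derivative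
      (\<Prod>j\<in>S. \<omega> k - a j) * (\<Sum>j\<in>S. 1 / (\<omega> k - a j))) (at (\<omega> k))"
    if "\<And>j. j \<in> S \<Longrightarrow> \<omega> k \<noteq> a j" for S and a :: "nat \<Rightarrow> complex"
    using that by (intro has_field_derivative_prod') (auto intro!: derivative_eq_intros)
  have rec: "((\<lambda>\<zeta>. \<Prod>j\<in>S. 1 / \<zeta> - cnj (a j)) has_field_derivative
      (\<Prod>j\<in>S. 1 / \<omega> k - cnj (a j)) * (- (\<Sum>j\<in>S. 1 / (1 - cnj (a j) * \<omega> k)) / \<omega> k)) (at (\<omega> k))"
    if "\<And>j. j \<in> S \<Longrightarrow> 1 / \<omega> k - cnj (a j) \<noteq> 0" for S and a :: "nat \<Rightarrow> complex"
  proof -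
    have "((\<lambda>\<zeta>. \<Prod>j\<in>S. 1 / \<zeta> - cnj (a j)) has_field_derivative
      (\<Prod>j\<in>S. 1 / \<omega> k - cnj (a j)) * (\<Sum>j\<in>S. (- 1 / (\<omega> k)\<^sup>2) / (1 / \<omega> k - cnj (a j)))) (at (\<omega> k))"
      using that zero_nz[OF k]
      by (intro has_field_derivative_prod')
        (auto intro!: derivative_eq_intros simp: power2_eq_square)
    also have "(\<Sum>j\<in>S. (- 1 / (\<omega> k)\<^sup>2) / (1 / \<omega> k - cnj (a j))) =
        (\<Sum>j\<in>S. - (1 / (1 - cnj (a j) * \<omega> k)) / \<omega> k)"
      using zero_nz[OF k] by (intro sum.cong) (auto simp: power2_eq_square field_simps)
    finally show ?thesis
      by (simp add: sum_divide_distrib sum_negf)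
  qed
  have nz1: "1 / \<omega> k - cnj (z j) \<noteq> 0" if "j \<in> {1..n}" for j
    using nz[OF that] zero_nz[OF k] pole_nz[OF that] by (auto simp: circle_refl_def field_simps)
  have nz2: "\<omega> k \<noteq> \<omega> j" if "j \<in> {1..m} - {k}" for j
    using that k zero_eq_iff by auto
  define a1 a2 b1 b2 where "a1 = (\<Prod>j=1..n. \<omega> k - z j)" "a2 = (\<Prod>j=1..n. 1 / \<omega> k - cnj (z j))"
    "b1 = (\<Prod>j\<in>{1..m} - {k}. \<omega> k - \<omega> j)" "b2 = (\<Prod>j=1..m. 1 / \<omega> k - cnj (\<omega> j))"
  note ab = this
  have b0: "b1 \<noteq> 0" "b2 \<noteq> 0"
    using nz2 inverse_minus_cnj_zero_nz[OF k] by (auto simp: ab)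
  have d: "((\<lambda>\<zeta>. c * ((p1 \<zeta> * p2 \<zeta>) / (r1 \<zeta> * r2 \<zeta>))) has_field_derivative
      c * ((a1 * a2) / (b1 * b2)) * (s1 + s2 - t1 - t2)) (at x)"
    if "(p1 has_field_derivative a1 * s1) (at x)" "(p2 has_field_derivative a2 * s2) (at x)"
      "(r1 has_field_derivative b1 * t1) (at x)" "(r2 has_field_derivative b2 * t2) (at x)"
      "p1 x = a1" "p2 x = a2" "r1 x = b1" "r2 x = b2"
    for p1 p2 r1 r2 :: "complex \<Rightarrow> complex" and c s1 s2 t1 t2 x
    by (rule DERIV_cong[OF DERIV_cmult[OF DERIV_divide[OF DERIV_mult[OF that(1,2)] DERIV_mult[OF that(3,4)]]]])
      (use b0 in \<open>auto simp: that field_simps\<close>)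
  have "(H k has_field_derivative of_real (q / (cmod b)\<^sup>2) * ((a1 * a2) / (b1 * b2)) *
     ((\<Sum>j=1..n. 1 / (\<omega> k - z j)) + - (\<Sum>j=1..n. 1 / (1 - cnj (z j) * \<omega> k)) / \<omega> k
      - (\<Sum>j\<in>{1..m}-{k}. 1 / (\<omega> k - \<omega> j)) - - (\<Sum>j=1..m. 1 / (1 - cnj (\<omega> j) * \<omega> k)) / \<omega> k))
     (at (\<omega> k))"
    unfolding H_def[abs_def]
    by (rule d)
      (use lin[of "{1..n}" z] lin[of "{1..m} - {k}" \<omega>] rec[of "{1..n}" z] rec[of "{1..m}" \<omega>]
         nz1 nz2 inverse_minus_cnj_zero_nz[OF k] zero_neq_pole[OF k] in \<open>auto simp: ab\<close>)
  then show ?thesis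
    unfolding A_eq_H[OF k] H_def ab by simp
qed

section \<open>Residues of \<open>h\<close> and its value at infinity\<close>

lemma H_isCont:
  assumes k: "k \<in> {1..m}"
  shows "isCont (H k) (\<omega> k)"
proof -
  have "\<omega> k \<noteq> \<omega> j" if "j \<in> {1..m} - {k}" for j
    using that k zero_eq_iff by auto
  then show ?thesis
    unfolding H_def[abs_def] using inverse_minus_cnj_zero_nz[OF k] zero_nz[OF k]
    by (intro continuous_intros) auto
qed

lemma tendsto_h_zero:
  assumes k: "k \<in> {1..m}"
  shows "((\<lambda>\<zeta>. (\<zeta> - \<omega> k) * h \<zeta>) \<longlongrightarrow> A k) (at (\<omega> k))"
proof (rule Lim_transform_eventually)
  show "(H k \<longlongrightarrow> A k) (at (\<omega> k))"
    using H_isCont[OF k] by (simp add: isCont_def A_eq_H[OF k])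
  show "\<forall>\<^sub>F \<zeta> in at (\<omega> k). H k \<zeta> = (\<zeta> - \<omega> k) * h \<zeta>"
    using h_mult_linear[OF k] by (auto simp: eventually_at_filter)
qed

text \<open>The residue at \<open>\<omega> k\<close> is carried over by \<open>h_reflect\<close>.
  The conjugate of \<open>1 / cnj \<zeta> - \<omega> k\<close> equals
  \<open>\<zeta> - circle_refl (\<omega> k)\<close> times
  \<open>- cnj (\<omega> k) / \<zeta>\<close>, and the inverse of this factor, taken at the
  reflected point, is \<open>- 1 / (cnj (\<omega> k))\<^sup>2\<close>.\<close>

lemma tendsto_h_refl_zero:
  assumes k: "k \<in> {1..m}"
  shows "((\<lambda>\<zeta>. (\<zeta> - circle_refl (\<omega> k)) * h \<zeta>) \<longlongrightarrow> - cnj (A k) / (cnj (\<omega> k))\<^sup>2)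
    (at (circle_refl (\<omega> k)))"
proof -
  let ?a = "circle_refl (\<omega> k)"
  have nz: "\<omega> k \<noteq> 0" "?a \<noteq> 0" using zero_nz[OF k] by (auto simp: circle_refl_def)
  have "filterlim (\<lambda>\<zeta>. 1 / cnj \<zeta>) (at (\<omega> k)) (at ?a)"
  proof (rule filterlim_atI)
    show "((\<lambda>\<zeta>. 1 / cnj \<zeta>) \<longlongrightarrow> \<omega> k) (at ?a)"
      using nz by (auto intro!: tendsto_eq_intros simp: circle_refl_def)
    show "\<forall>\<^sub>F \<zeta> in at ?a. 1 / cnj \<zeta> \<noteq> \<omega> k"
      using eventually_neq_at_within[of ?a ?a UNIV]
    proof eventually_elim
      case (elim \<zeta>)
      show ?case
      proof
        assume eq: "1 / cnj \<zeta> = \<omega> k"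
        then have "?a = \<zeta>" by (simp add: circle_refl_def flip: eq)
        then show False using elim by simp
      qed
    qed
  qed
  then have "((\<lambda>\<zeta>. (1 / cnj \<zeta> - \<omega> k) * h (1 / cnj \<zeta>)) \<longlongrightarrow> A k) (at ?a)"
    by (rule filterlim_compose[OF tendsto_h_zero[OF k]])
  then have "((\<lambda>\<zeta>. (1 / cnj \<zeta> - \<omega> k) * cnj (h \<zeta>)) \<longlongrightarrow> A k) (at ?a)"
    by (simp only: h_reflect)
  then have "((\<lambda>\<zeta>. - \<zeta> / cnj (\<omega> k) * cnj ((1 / cnj \<zeta> - \<omega> k) * cnj (h \<zeta>)))
      \<longlongrightarrow> - ?a / cnj (\<omega> k) * cnj (A k)) (at ?a)"
    using nz by (intro tendsto_intros) auto
  also have "- ?a / cnj (\<omega> k) * cnj (A k) = - cnj (A k) / (cnj (\<omega> k))\<^sup>2"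
    by (simp add: circle_refl_def power2_eq_square)
  finally show ?thesis
  proof (rule Lim_transform_eventually)
    have "\<forall>\<^sub>F \<zeta> in at ?a. \<zeta> \<in> - {0} - {?a}"
      using nz by (intro eventually_at_in_open) auto
    then show "\<forall>\<^sub>F \<zeta> in at ?a. - \<zeta> / cnj (\<omega> k) * cnj ((1 / cnj \<zeta> - \<omega> k) * cnj (h \<zeta>)) = (\<zeta> - ?a) * h \<zeta>"
    proof eventually_elim
      case (elim \<zeta>)
      then show ?case using nz by (simp add: circle_refl_def field_simps)
    qed
  qed
qed

text \<open>Pair \<open>n\<close> of the denominators \<open>\<zeta> - \<omega> j\<close> with the
  numerators; each pair tends to 1. The other \<open>m - n\<close> factors tend to 0, and for
  \<open>m = n\<close> their product is empty, hence 1. In that case the signs in the two remaining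
  products cancel.\<close>

lemma h_tendsto_infinity:
  "(h \<longlongrightarrow> (if m = n then of_real q * (\<Prod>j=1..n. cnj (z j))
       / (of_real ((cmod b)\<^sup>2) * (\<Prod>j=1..m. cnj (\<omega> j))) else 0)) at_infinity"
proof -
  have inv: "((\<lambda>\<zeta>::complex. 1 / \<zeta>) \<longlongrightarrow> 0) at_infinity"
    using tendsto_inverse_shift_infinity[of 1 0] by simp
  have split: "{1..m} = {1..n} \<union> {Suc n..m}" "{1..n} \<inter> {Suc n..m} = {}"
    using n_le_m by auto
  have heq: "h \<zeta> = of_real (q / (cmod b)\<^sup>2) * ((\<Prod>j=1..n. (\<zeta> - z j) / (\<zeta> - \<omega> j)) *
      (\<Prod>j\<in>{Suc n..m}. 1 / (\<zeta> - \<omega> j)) *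
      ((\<Prod>j=1..n. 1 / \<zeta> - cnj (z j)) / (\<Prod>j=1..m. 1 / \<zeta> - cnj (\<omega> j))))" for \<zeta>
    unfolding h_eq prod_dividef
    by (subst (1) split(1), subst prod.union_disjoint) (use split(2) in auto)
  have fac: "((\<lambda>\<zeta>. (\<zeta> - a) / (\<zeta> - w)) \<longlongrightarrow> 1) at_infinity" for a w :: complex
  proof -
    have "((\<lambda>\<zeta>. \<zeta> / (\<zeta> - w) - a / (\<zeta> - w)) \<longlongrightarrow> 1 - 0) at_infinity"
      by (intro tendsto_intros tendsto_ratio_infinity tendsto_inverse_shift_infinity)
    then show ?thesis by (simp add: diff_divide_distrib)
  qed
  have "(h \<longlongrightarrow> of_real (q / (cmod b)\<^sup>2) * ((\<Prod>j=1..n. 1) * (\<Prod>j\<in>{Suc n..m}. 0) *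
      ((\<Prod>j=1..n. 0 - cnj (z j)) / (\<Prod>j=1..m. 0 - cnj (\<omega> j))))) at_infinity"
    unfolding heq[abs_def]
    by (intro tendsto_intros fac tendsto_inverse_shift_infinity inv) (use zero_nz in auto)
  moreover have "of_real (q / (cmod b)\<^sup>2) * ((\<Prod>j=1..n. 1) * (\<Prod>j\<in>{Suc n..m}. 0) *
      ((\<Prod>j=1..n. 0 - cnj (z j)) / (\<Prod>j=1..m. 0 - cnj (\<omega> j)))) =
      (if m = n then of_real q * (\<Prod>j=1..n. cnj (z j))
       / (of_real ((cmod b)\<^sup>2) * (\<Prod>j=1..m. cnj (\<omega> j))) else 0)"
    using n_le_m by (auto simp: prod_uminus)
  ultimately show ?thesis by simp
qed

lemma A_inf_eq:
  "Ainf = (if m = n then of_real q * (\<Prod>j=1..n. cnj (z j))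
       / (of_real ((cmod b)\<^sup>2) * (\<Prod>j=1..m. cnj (\<omega> j))) else 0)"
  unfolding coef_A_inf_def
  using h_tendsto_infinity by (intro tendsto_Lim trivial_limit_at_infinity) (simp add: h_def[abs_def])

lemma tendsto_A_inf: "(h \<longlongrightarrow> Ainf) at_infinity"
  unfolding A_inf_eq by (rule h_tendsto_infinity)


section \<open>Partial fraction expansion of \<open>h\<close>\<close>

definition D :: "complex \<Rightarrow> complex" where
  "D \<zeta> = of_real (Re C) + (\<Sum>k=1..m. A k / (\<zeta> - \<omega> k))
     + (\<Sum>k=1..m. cnj (A k) * \<zeta> / (1 - cnj (\<omega> k) * \<zeta>))"

definition poles :: "complex set" where
  "poles = \<omega> ` {1..m} \<union> (\<lambda>k. circle_refl (\<omega> k)) ` {1..m}"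

lemma finite_poles: "finite poles"
  by (simp add: poles_def)

text \<open>Multiplying numerator and denominator by \<open>\<zeta> ^ m\<close> clears the powers of
  \<open>1 / \<zeta>\<close>; the numerator keeps the factor \<open>\<zeta> ^ (m - n)\<close> and
  has degree at most \<open>m + n\<close>. The zeros and their reflections are \<open>2 * m\<close>
  distinct points, so the degree bound of \<open>partial_fractions\<close> is met.\<close>

lemma h_partial_fractions_aux:
  obtains \<kappa> r where "\<And>\<zeta>. \<zeta> \<notin> insert 0 poles \<Longrightarrow> h \<zeta> = \<kappa> + (\<Sum>a\<in>poles. r a / (\<zeta> - a))"
proof -
  define p :: "complex poly" where "p = smult (of_real (q / (cmod b)\<^sup>2) / (\<Prod>j=1..m. - cnj (\<omega> j)))
    (monom 1 (m - n) * ((\<Prod>j=1..n. [:- z j, 1:]) * (\<Prod>j=1..n. [:1, - cnj (z j):])))"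
  have inj2: "inj_on (\<lambda>k. circle_refl (\<omega> k)) {1..m}"
    by (rule inj_onI) (use zero_eq_iff in \<open>auto simp: circle_refl_def\<close>)
  have disj: "\<omega> ` {1..m} \<inter> (\<lambda>k. circle_refl (\<omega> k)) ` {1..m} = {}"
    using zero_neq_refl by auto
  have card: "card poles = m + m"
    unfolding poles_def using inj_zero inj2 disj
    by (subst card_Un_disjoint) (auto simp: card_image)
  have dp: "degree (\<Prod>j=1..n. [:- z j, 1:]) \<le> n" "degree (\<Prod>j=1..n. [:1, - cnj (z j):]) \<le> n"
    by (rule order.trans[OF degree_prod_sum_le] order.trans[OF sum_bounded_above[of _ _ 1]]; simp)+
  have "degree p \<le> (m - n) + (n + n)"
    unfolding p_def
    by (intro order.trans[OF degree_smult_le] order.trans[OF degree_mult_le] add_mono dp)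
      (auto simp: degree_monom_eq)
  also have "\<dots> \<le> card poles" using n_le_m card by simp
  finally obtain \<kappa> r where r: "\<And>x. x \<notin> poles \<Longrightarrow>
      poly p x / (\<Prod>a\<in>poles. x - a) = \<kappa> + (\<Sum>a\<in>poles. r a / (x - a))"
    using partial_fractions finite_poles by metis
  have "h \<zeta> = poly p \<zeta> / (\<Prod>a\<in>poles. \<zeta> - a)" if "\<zeta> \<notin> insert 0 poles" for \<zeta>
  proof -
    have nz: "\<zeta> \<noteq> 0" using that by auto
    have "(\<Prod>a\<in>poles. \<zeta> - a) = (\<Prod>j=1..m. \<zeta> - \<omega> j) * (\<Prod>j=1..m. \<zeta> - circle_refl (\<omega> j))"
      unfolding poles_def
      by (simp only: prod.union_disjoint[OF _ _ disj] prod.reindex[OF inj_zero] prod.reindex[OF inj2]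
          o_def finite_imageI finite_atLeastAtMost)
    moreover have "(\<Prod>j=1..m. - cnj (\<omega> j)) * (\<Prod>j=1..m. \<zeta> - circle_refl (\<omega> j)) =
        (\<Prod>j=1..m. \<zeta> * (1 / \<zeta> - cnj (\<omega> j)))"
      unfolding prod.distrib[symmetric] using nz zero_nz
      by (intro prod.cong) (auto simp: circle_refl_def field_simps)
    moreover have "(\<Prod>j=1..n. 1 - \<zeta> * cnj (z j)) = (\<Prod>j=1..n. \<zeta> * (1 / \<zeta> - cnj (z j)))"
      using nz by (intro prod.cong) (auto simp: field_simps)
    moreover have "\<zeta> ^ m = \<zeta> ^ (m - n) * \<zeta> ^ n"
      using n_le_m by (simp flip: power_add)
    ultimately show ?thesis
      unfolding h_eq p_def using nz
      by (simp add: poly_prod poly_monom prod.distrib) (simp add: field_simps)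
  qed
  then show ?thesis using r that by auto
qed

text \<open>Residues fix all coefficients but the constant. The constant is \<open>Ainf\<close> plus
  what is split off from the fractions at the reflected zeros, and the symmetry of \<open>h\<close>
  forces it to be real; this is where the real part in \<open>const_C\<close> comes from.\<close>

lemma h_partial_fractions:
  assumes "\<zeta> \<notin> insert 0 poles"
  shows "h \<zeta> = D \<zeta>"
proof -
  obtain \<kappa>0 r where r: "\<And>\<zeta>. \<zeta> \<notin> insert 0 poles \<Longrightarrow> h \<zeta> = \<kappa>0 + (\<Sum>a\<in>poles. r a / (\<zeta> - a))"
    using h_partial_fractions_aux by blast
  have res: "((\<lambda>\<zeta>. (\<zeta> - a) * h \<zeta>) \<longlongrightarrow> r a) (at a)" if "a \<in> poles" for a
  proof (rule Lim_transform_eventually)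
    have "((\<lambda>\<zeta>. (\<zeta> - a) * \<kappa>0 + (\<zeta> - a) * (\<Sum>i\<in>poles. r i / (\<zeta> - i)))
        \<longlongrightarrow> (a - a) * \<kappa>0 + (\<Sum>i | i \<in> poles \<and> i = a. r i)) (at a)"
      by (intro tendsto_intros tendsto_sum_simple_poles finite_poles)
    moreover have "{i. i \<in> poles \<and> i = a} = {a}" using that by auto
    ultimately show "((\<lambda>\<zeta>. (\<zeta> - a) * \<kappa>0 + (\<zeta> - a) * (\<Sum>i\<in>poles. r i / (\<zeta> - i))) \<longlongrightarrow> r a) (at a)"
      by simp
    have "\<forall>\<^sub>F \<zeta> in at a. \<zeta> \<notin> insert a (insert 0 poles)"
      using finite_poles by (intro eventually_at_avoids_finite) simp
    then show "\<forall>\<^sub>F \<zeta> in at a. (\<zeta> - a) * \<kappa>0 + (\<zeta> - a) * (\<Sum>i\<in>poles. r i / (\<zeta> - i)) = (\<zeta> - a) * h \<zeta>"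
      by eventually_elim (subst r, auto simp: distrib_left)
  qed
  have rA: "r (\<omega> k) = A k" if "k \<in> {1..m}" for k
    using tendsto_unique[OF _ res tendsto_h_zero[OF that]] that by (simp add: poles_def)
  have rA': "r (circle_refl (\<omega> k)) = - cnj (A k) / (cnj (\<omega> k))\<^sup>2" if "k \<in> {1..m}" for k
    using tendsto_unique[OF _ res tendsto_h_refl_zero[OF that]] that by (simp add: poles_def)
  have inj2: "inj_on (\<lambda>k. circle_refl (\<omega> k)) {1..m}"
    by (rule inj_onI) (use zero_eq_iff in \<open>auto simp: circle_refl_def\<close>)
  have disj: "\<omega> ` {1..m} \<inter> (\<lambda>k. circle_refl (\<omega> k)) ` {1..m} = {}"
    using zero_neq_refl by auto
  \<comment> \<open>The fraction at \<open>circle_refl (\<omega> k)\<close> equals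
    \<open>cnj (A k / \<omega> k)\<close> plus a term that vanishes at 0; the constants are gathered
    in \<open>\<kappa>\<close>.\<close>
  define \<kappa> where "\<kappa> = \<kappa>0 + (\<Sum>k=1..m. cnj (A k / \<omega> k))"
  have eq: "h \<zeta> = \<kappa> + (\<Sum>k=1..m. A k / (\<zeta> - \<omega> k))
     + (\<Sum>k=1..m. cnj (A k) * \<zeta> / (1 - cnj (\<omega> k) * \<zeta>))" if \<zeta>: "\<zeta> \<notin> insert 0 poles" for \<zeta>
  proof -
    have "h \<zeta> = \<kappa>0 + ((\<Sum>k=1..m. r (\<omega> k) / (\<zeta> - \<omega> k))
        + (\<Sum>k=1..m. r (circle_refl (\<omega> k)) / (\<zeta> - circle_refl (\<omega> k))))"
      unfolding r[OF \<zeta>] unfolding poles_def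
      by (simp only: sum.union_disjoint[OF _ _ disj] sum.reindex[OF inj_zero] sum.reindex[OF inj2]
          o_def finite_imageI finite_atLeastAtMost)
    also have "(\<Sum>k=1..m. r (\<omega> k) / (\<zeta> - \<omega> k)) = (\<Sum>k=1..m. A k / (\<zeta> - \<omega> k))"
      using rA by simp
    also have "(\<Sum>k=1..m. r (circle_refl (\<omega> k)) / (\<zeta> - circle_refl (\<omega> k))) =
        (\<Sum>k=1..m. cnj (A k / \<omega> k) + cnj (A k) * \<zeta> / (1 - cnj (\<omega> k) * \<zeta>))"
    proof (rule sum.cong)
      fix k assume k: "k \<in> {1..m}"
      have 1: "cnj (\<omega> k) \<noteq> 0" "1 - cnj (\<omega> k) * \<zeta> \<noteq> 0"
        using zero_nz[OF k] refl_denom_eq_0_iff[OF k, of \<zeta>] \<zeta> k by (auto simp: poles_def)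
      have 2: "\<zeta> - circle_refl (\<omega> k) = - (1 - cnj (\<omega> k) * \<zeta>) / cnj (\<omega> k)"
        using 1 by (simp add: circle_refl_def field_simps)
      show "r (circle_refl (\<omega> k)) / (\<zeta> - circle_refl (\<omega> k)) =
          cnj (A k / \<omega> k) + cnj (A k) * \<zeta> / (1 - cnj (\<omega> k) * \<zeta>)"
        unfolding rA'[OF k] 2 using 1 by (simp add: divide_simps power2_eq_square) (simp add: algebra_simps)
    qed simp
    finally show ?thesis by (simp add: \<kappa>_def sum.distrib)
  qed
  have "((\<lambda>\<zeta>. \<kappa>0 + (\<Sum>a\<in>poles. r a / (\<zeta> - a))) \<longlongrightarrow> \<kappa>0 + (\<Sum>a\<in>poles. 0)) at_infinity"
    by (intro tendsto_intros tendsto_inverse_shift_infinity)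
  then have "((\<lambda>\<zeta>. \<kappa>0 + (\<Sum>a\<in>poles. r a / (\<zeta> - a))) \<longlongrightarrow> \<kappa>0) at_infinity"
    by simp
  then have "(h \<longlongrightarrow> \<kappa>0) at_infinity"
  proof (rule Lim_transform_eventually)
    have "bounded (insert 0 poles)" using finite_poles by (simp add: finite_imp_bounded)
    then obtain B where "\<And>x. x \<in> insert 0 poles \<Longrightarrow> norm x \<le> B"
      unfolding bounded_iff by blast
    then show "\<forall>\<^sub>F \<zeta> in at_infinity. \<kappa>0 + (\<Sum>a\<in>poles. r a / (\<zeta> - a)) = h \<zeta>"
      unfolding eventually_at_infinity
      by (intro exI[of _ "B + 1"] allI impI) (subst r, force+)
  qed
  then have "\<kappa>0 = Ainf"
    using tendsto_unique[OF trivial_limit_at_infinity] tendsto_A_inf by blast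
  then have \<kappa>1: "\<kappa> = Ainf + cnj (\<Sum>k=1..m. A k / \<omega> k)"
    by (simp add: \<kappa>_def)
  \<comment> \<open>At the point 1 of the circle \<open>h\<close> is real and the two sums are
    conjugate to each other, so the constant is real.\<close>
  have "\<kappa> = cnj \<kappa>"
  proof -
    have 1: "1 \<notin> insert 0 poles"
      using norm_zero_neq_1 by (force simp: poles_def circle_refl_def)
    have 2: "cnj (h 1) = h 1" using h_reflect[of 1] by simp
    have 3: "(\<Sum>k=1..m. cnj (A k) * 1 / (1 - cnj (\<omega> k) * 1)) = cnj (\<Sum>k=1..m. A k / (1 - \<omega> k))"
      by simp
    show ?thesis using 2 unfolding eq[OF 1] 3 by (auto simp: algebra_simps)
  qed
  then have "\<kappa> = of_real (Re \<kappa>)" by (simp add: complex_eq_iff)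
  also have "Re \<kappa> = Re C"
    by (simp only: \<kappa>1 const_C_def plus_complex.sel cnj.sel) simp
  finally have \<kappa>: "\<kappa> = of_real (Re C)" .
  show ?thesis
    using eq[OF assms] unfolding \<kappa> D_def .
qed

text \<open>A term by term identity between explicit sums. With \<open>D\<close> in place of
  \<open>h\<close> it holds at every nonzero point: where a denominator vanishes, both sides drop
  the same term.\<close>

lemma Q_add_reflect:
  assumes "\<zeta> \<noteq> 0"
  shows "Q \<zeta> + cnj (Q (circle_refl \<zeta>)) = 2 * D \<zeta>"
proof -
  have "cnj (2 * A k / (circle_refl \<zeta> - \<omega> k)) = 2 * (cnj (A k) * \<zeta> / (1 - cnj (\<omega> k) * \<zeta>))" for k
  proof -
    have "cnj (circle_refl \<zeta> - \<omega> k) = (1 - cnj (\<omega> k) * \<zeta>) / \<zeta>"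
      using assms by (simp add: circle_refl_def field_simps)
    then show ?thesis by simp
  qed
  then have "cnj (Q (circle_refl \<zeta>)) = cnj C + 2 * (\<Sum>k=1..m. cnj (A k) * \<zeta> / (1 - cnj (\<omega> k) * \<zeta>))"
    by (simp add: Q_def sum_distrib_left)
  moreover have "C + cnj C = 2 * of_real (Re C)" by (simp add: complex_add_cnj)
  moreover have "Q \<zeta> = C + 2 * (\<Sum>k=1..m. A k / (\<zeta> - \<omega> k))"
    by (simp add: Q_def sum_distrib_left)
  ultimately show ?thesis by (simp add: D_def algebra_simps)
qed

section \<open>The reflection identity at the poles and zeros of \<open>g\<close>\<close>

lemma isCont_Q:
  assumes "\<And>k. k \<in> {1..m} \<Longrightarrow> \<zeta> \<noteq> \<omega> k"
  shows "isCont Q \<zeta>"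
  unfolding Q_def[abs_def] using assms by (intro continuous_intros) auto

text \<open>At a pole of \<open>g\<close> the function \<open>h\<close> vanishes, unless the pole is
  the reflection of a zero \<open>\<omega> l\<close>: then a zero of \<open>star g\<close> cancels
  one factor of \<open>1 / g\<close>, and a second copy of the pole is required to make the limit 0.
  For a simple pole in that position the limit is nonzero whenever
  \<open>q \<noteq> 0\<close>.\<close>

lemma Q_add_reflect_pole:
  assumes j: "j \<in> {1..n}"
    and "(\<forall>k\<in>{1..m}. z j \<noteq> circle_refl (\<omega> k)) \<or> (\<exists>i\<in>{1..n} - {j}. z i = z j)"
  shows "Q (z j) + cnj (Q (circle_refl (z j))) = 0"
proof -
  let ?a = "z j"
  have a: "?a \<noteq> 0" "\<And>k. k \<in> {1..m} \<Longrightarrow> ?a \<noteq> \<omega> k"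
    using pole_nz[OF j] zero_neq_pole[OF _ j] by force+
  have "D ?a = 0"
  proof (cases "\<forall>k\<in>{1..m}. ?a \<noteq> circle_refl (\<omega> k)")
    case True
    then have "?a \<notin> insert 0 poles"
      using a unfolding poles_def by blast
    then have "D ?a = h ?a"
      using h_partial_fractions[of ?a] by simp
    also have "\<dots> = 0"
      using j by (auto simp: h_eq)
    finally show ?thesis .
  next
    case False
    then obtain l where l: "l \<in> {1..m}" "?a = circle_refl (\<omega> l)" by auto
    obtain i where i: "i \<in> {1..n}" "i \<noteq> j" "z i = ?a"
      using False assms(2) by blast
    have wl: "cnj (\<omega> l) = 1 / ?a" "circle_refl (\<omega> l) = ?a"
      using l zero_nz[OF l(1)] by (auto simp: circle_refl_def)
    have "(\<Prod>j=1..n. cnj (circle_refl (\<omega> l) - z j)) = 0"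
      using j wl by auto
    then have Al: "A l = 0" by (simp add: A_eq[OF l(1)])
    have other: "1 - cnj (\<omega> k) * ?a \<noteq> 0" if "k \<in> {1..m}" "k \<noteq> l" for k
      using refl_denom_eq_0_iff[OF that(1)] zero_eq_iff[OF that(1) l(1)] that l
      by (auto simp: circle_refl_def)
    \<comment> \<open>Because \<open>A l = 0\<close>, the only summand of \<open>D\<close> that is
      singular at \<open>z j\<close> disappears. \<open>D\<close> is therefore continuous there and
      can be compared with the limit of \<open>h\<close>.\<close>
    have D': "D \<zeta> = of_real (Re C) + (\<Sum>k=1..m. A k / (\<zeta> - \<omega> k))
        + (\<Sum>k\<in>{1..m}-{l}. cnj (A k) * \<zeta> / (1 - cnj (\<omega> k) * \<zeta>))" for \<zeta>
      unfolding D_def using l(1) Al by (subst (2) sum.remove[of _ l]) auto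
    have "isCont D ?a"
      unfolding D'[abs_def] using a other by (intro continuous_intros) auto
    then have lim1: "(D \<longlongrightarrow> D ?a) (at ?a)" by (simp add: isCont_def)
    have ev: "\<forall>\<^sub>F \<zeta> in at ?a. \<zeta> \<notin> insert ?a (insert 0 poles)"
      using finite_poles by (intro eventually_at_avoids_finite) simp
    \<comment> \<open>\<open>U\<close> is \<open>h\<close> with the quotient of
      \<open>\<zeta> - z j\<close> by \<open>1 / \<zeta> - 1 / z j\<close> replaced by its value
      \<open>- \<zeta> * z j\<close>. The factor \<open>\<zeta> - z j\<close> that remains belongs
      to the second copy of the pole.\<close>
    define U where "U = (\<lambda>\<zeta>. of_real (q / (cmod b)\<^sup>2) * (- \<zeta> * ?a * (\<zeta> - ?a) *
        (((\<Prod>j\<in>{1..n}-{i,j}. \<zeta> - z j) * (\<Prod>j=1..n. 1 / \<zeta> - cnj (z j)))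
         / ((\<Prod>j=1..m. \<zeta> - \<omega> j) * (\<Prod>j\<in>{1..m}-{l}. 1 / \<zeta> - cnj (\<omega> j))))))"
    have hU: "h \<zeta> = U \<zeta>" if "\<zeta> \<noteq> 0" "\<zeta> \<noteq> ?a" for \<zeta>
    proof -
      have 1: "(\<Prod>j=1..n. \<zeta> - z j) = (\<zeta> - ?a) * (\<zeta> - ?a) * (\<Prod>j\<in>{1..n}-{i,j}. \<zeta> - z j)"
      proof -
        have "(\<Prod>j=1..n. \<zeta> - z j) = (\<zeta> - z j) * ((\<zeta> - z i) * (\<Prod>j\<in>{1..n}-{j}-{i}. \<zeta> - z j))"
          using i j by (subst prod.remove[of _ j], simp, simp, subst prod.remove[of _ i]) auto
        also have "{1..n}-{j}-{i} = {1..n}-{i,j}" by auto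
        finally show ?thesis using i by simp
      qed
      have 2: "(\<Prod>j=1..m. 1 / \<zeta> - cnj (\<omega> j)) =
          (1 / \<zeta> - 1 / ?a) * (\<Prod>j\<in>{1..m}-{l}. 1 / \<zeta> - cnj (\<omega> j))"
        using l wl by (subst prod.remove[of _ l]) auto
      have 3: "(\<zeta> - ?a) / (1 / \<zeta> - 1 / ?a) = - \<zeta> * ?a"
        using that a by (simp add: divide_simps) (simp add: algebra_simps)
      have "h \<zeta> = of_real (q / (cmod b)\<^sup>2) * ((\<zeta> - ?a) / (1 / \<zeta> - 1 / ?a) * (\<zeta> - ?a) *
        (((\<Prod>j\<in>{1..n}-{i,j}. \<zeta> - z j) * (\<Prod>j=1..n. 1 / \<zeta> - cnj (z j)))
         / ((\<Prod>j=1..m. \<zeta> - \<omega> j) * (\<Prod>j\<in>{1..m}-{l}. 1 / \<zeta> - cnj (\<omega> j)))))"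
        unfolding h_eq 1 2 by (simp add: mult_ac)
      then show ?thesis unfolding 3 U_def .
    qed
    have "1 / ?a - cnj (\<omega> k) \<noteq> 0" if "k \<in> {1..m} - {l}" for k
      using other[of k] that a by (auto simp: field_simps)
    then have "isCont U ?a"
      unfolding U_def using a by (intro continuous_intros) auto
    moreover have "U ?a = 0" by (simp add: U_def)
    ultimately have "(U \<longlongrightarrow> 0) (at ?a)" by (simp add: isCont_def)
    then have "(D \<longlongrightarrow> 0) (at ?a)"
    proof (rule Lim_transform_eventually)
      show "\<forall>\<^sub>F \<zeta> in at ?a. U \<zeta> = D \<zeta>"
        using ev
      proof eventually_elim
        case (elim \<zeta>)
        then have *: "\<zeta> \<noteq> 0" "\<zeta> \<noteq> ?a" "\<zeta> \<notin> poles" using a by auto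
        show ?case
          using hU[OF *(1,2)] h_partial_fractions[of \<zeta>] * by simp
      qed
    qed
    then show ?thesis using lim1 tendsto_unique[OF at_neq_bot] by blast
  qed
  then show ?thesis using Q_add_reflect[OF a(1)] by simp
qed

text \<open>Comparison of the constant Laurent coefficients at \<open>\<omega> k\<close>. Once the
  polar part \<open>2 * A k / (\<zeta> - \<omega> k)\<close> is removed from \<open>2 * h\<close>,
  twice the difference quotient of \<open>H k\<close> is left, and its limit is twice the derivative
  of \<open>H k\<close>.\<close>

lemma Q_add_reflect_zero:
  assumes k: "k \<in> {1..m}" and nz: "\<And>j. j \<in> {1..n} \<Longrightarrow> \<omega> k \<noteq> circle_refl (z j)"
  shows "C + (\<Sum>j\<in>{1..m}-{k}. 2 * A j / (\<omega> k - \<omega> j)) + cnj (Q (circle_refl (\<omega> k))) =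
    2 * A k * ((\<Sum>j=1..n. 1 / (\<omega> k - z j)) - (\<Sum>j=1..n. 1 / (1 - cnj (z j) * \<omega> k)) / \<omega> k
      - (\<Sum>j\<in>{1..m}-{k}. 1 / (\<omega> k - \<omega> j)) + (\<Sum>j=1..m. 1 / (1 - cnj (\<omega> j) * \<omega> k)) / \<omega> k)"
    (is "?lhs = 2 * A k * ?S")
proof -
  let ?w = "\<omega> k"
  have w0: "?w \<noteq> 0" using zero_nz[OF k] .
  have "((\<lambda>\<zeta>. (H k \<zeta> - H k ?w) / (\<zeta> - ?w)) \<longlongrightarrow> A k * ?S) (at ?w)"
    using H_has_derivative[OF k nz] by (simp add: has_field_derivative_iff)
  then have 1: "((\<lambda>\<zeta>. 2 * ((H k \<zeta> - H k ?w) / (\<zeta> - ?w))) \<longlongrightarrow> 2 * (A k * ?S)) (at ?w)"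
    by (intro tendsto_intros)
  have "?w \<noteq> \<omega> j" if "j \<in> {1..m} - {k}" for j
    using that k zero_eq_iff by auto
  moreover have "((\<lambda>\<zeta>. Q (circle_refl \<zeta>)) \<longlongrightarrow> Q (circle_refl ?w)) (at ?w)"
  proof (rule isCont_tendsto_compose[where g = Q])
    have "circle_refl ?w \<noteq> \<omega> j" if "j \<in> {1..m}" for j
      using zero_neq_refl[OF that k] by auto
    then show "isCont Q (circle_refl ?w)" by (rule isCont_Q)
    show "(circle_refl \<longlongrightarrow> circle_refl ?w) (at ?w)"
      unfolding circle_refl_def using w0 by (intro tendsto_intros) auto
  qed
  ultimately have 2: "((\<lambda>\<zeta>. C + (\<Sum>j\<in>{1..m}-{k}. 2 * A j / (\<zeta> - \<omega> j)) + cnj (Q (circle_refl \<zeta>)))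
      \<longlongrightarrow> ?lhs) (at ?w)"
    by (intro tendsto_intros) auto
  have "\<forall>\<^sub>F \<zeta> in at ?w. \<zeta> \<notin> insert ?w (insert 0 poles)"
    using finite_poles by (intro eventually_at_avoids_finite) simp
  then have "\<forall>\<^sub>F \<zeta> in at ?w. C + (\<Sum>j\<in>{1..m}-{k}. 2 * A j / (\<zeta> - \<omega> j)) + cnj (Q (circle_refl \<zeta>)) =
      2 * ((H k \<zeta> - H k ?w) / (\<zeta> - ?w))"
  proof eventually_elim
    case (elim \<zeta>)
    then have z: "\<zeta> \<noteq> 0" "\<zeta> \<notin> poles" "\<zeta> \<noteq> ?w" using w0 by auto
    have "h \<zeta> = D \<zeta>"
      using h_partial_fractions[of \<zeta>] z by simp
    then have "Q \<zeta> + cnj (Q (circle_refl \<zeta>)) = 2 * h \<zeta>"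
      using Q_add_reflect[OF z(1)] by simp
    moreover have "Q \<zeta> = C + (\<Sum>j\<in>{1..m}-{k}. 2 * A j / (\<zeta> - \<omega> j)) + 2 * A k / (\<zeta> - ?w)"
      unfolding Q_def using k by (subst sum.remove[of _ k]) auto
    moreover have "H k \<zeta> = (\<zeta> - ?w) * h \<zeta>" "H k ?w = A k"
      using h_mult_linear[OF k z(3)] A_eq_H[OF k] by auto
    ultimately have "C + (\<Sum>j\<in>{1..m}-{k}. 2 * A j / (\<zeta> - \<omega> j)) + cnj (Q (circle_refl \<zeta>)) =
        2 * h \<zeta> - 2 * A k / (\<zeta> - ?w)"
      by (simp add: algebra_simps)
    also have "\<dots> = 2 * ((H k \<zeta> - H k ?w) / (\<zeta> - ?w))"
      using z(3) by (simp add: \<open>H k \<zeta> = (\<zeta> - ?w) * h \<zeta>\<close> \<open>H k ?w = A k\<close> field_simps)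
    finally show ?case .
  qed
  with 2 have "((\<lambda>\<zeta>. 2 * ((H k \<zeta> - H k ?w) / (\<zeta> - ?w))) \<longlongrightarrow> ?lhs) (at ?w)"
    by (rule Lim_transform_eventually)
  from tendsto_unique[OF at_neq_bot this 1] show ?thesis by simp
qed

end

section \<open>The Poisson integral\<close>

context zero_pole_data begin

definition outer_zeros :: "nat set" where "outer_zeros = {k \<in> {1..m}. \<omega> k \<notin> ball 0 1}"
definition inner_zeros :: "nat set" where "inner_zeros = {k \<in> {1..m}. \<omega> k \<in> ball 0 1}"

definition poisson_poles :: "complex set" where
  "poisson_poles = \<omega> ` outer_zeros \<union> (\<lambda>k. circle_refl (\<omega> k)) ` inner_zeros"

lemma sum_outer_inner: "(\<Sum>k=1..m. u k) = (\<Sum>k\<in>outer_zeros. u k) + (\<Sum>k\<in>inner_zeros. u k)"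
  by (subst sum.union_disjoint[symmetric]) (auto simp: outer_zeros_def inner_zeros_def intro!: sum.cong)

lemma finite_outer_inner: "finite outer_zeros" "finite inner_zeros"
  by (simp_all add: outer_zeros_def inner_zeros_def)

lemma norm_outer: "k \<in> outer_zeros \<Longrightarrow> cmod (\<omega> k) > 1"
  using norm_zero_neq_1[of k] by (auto simp: outer_zeros_def)

lemma norm_inner: "k \<in> inner_zeros \<Longrightarrow> cmod (\<omega> k) < 1"
  by (simp add: inner_zeros_def)

lemma inner_denom_nz:
  assumes "k \<in> inner_zeros" "\<zeta> \<in> cball 0 1"
  shows "1 - cnj (\<omega> k) * \<zeta> \<noteq> 0"
proof
  assume "1 - cnj (\<omega> k) * \<zeta> = 0"
  then have "cmod (\<omega> k) * cmod \<zeta> = 1"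
    by (metis complex_mod_cnj eq_iff_diff_eq_0 norm_mult norm_one)
  moreover have "cmod (\<omega> k) * cmod \<zeta> \<le> cmod (\<omega> k) * 1"
    using assms(2) by (intro mult_left_mono) auto
  ultimately show False using norm_inner[OF assms(1)] by simp
qed

lemma ball_avoids_poisson_poles: "ball 0 1 \<inter> poisson_poles = {}"
proof -
  have "circle_refl (\<omega> k) \<notin> ball 0 1" if "k \<in> inner_zeros" for k
  proof
    assume "circle_refl (\<omega> k) \<in> ball 0 1"
    moreover have "\<omega> k \<noteq> 0" using that zero_nz by (simp add: inner_zeros_def)
    ultimately show False
      using inner_denom_nz[OF that, of "circle_refl (\<omega> k)"] by (auto simp: circle_refl_def)
  qed
  then show ?thesis by (auto simp: poisson_poles_def outer_zeros_def)
qed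

lemma circle_avoids_poles:
  assumes "cmod \<zeta> = 1"
  shows "\<zeta> \<notin> insert 0 poles"
  using assms norm_zero_neq_1 by (auto simp: poles_def circle_refl_def norm_divide)

lemma h_circle:
  assumes "cmod \<zeta> = 1"
  shows "h \<zeta> = of_real (q / (cmod (g \<zeta>))\<^sup>2)"
proof -
  have "\<zeta> * cnj \<zeta> = 1" using assms by (simp add: complex_norm_square[symmetric])
  moreover have "\<zeta> \<noteq> 0" using assms by auto
  ultimately have "1 / cnj \<zeta> = \<zeta>" by (simp add: field_simps)
  then show ?thesis
    unfolding h_def star_def of_real_divide complex_norm_square by simp
qed

text \<open>Only the real part of \<open>C\<close> is kept: an imaginary constant changes neither
  the real part on the circle nor the Poisson integral, and \<open>poisson_integral_eq\<close>
  normalises it away.\<close>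

definition F :: "complex \<Rightarrow> complex" where
  "F \<zeta> = of_real (Re C) + (\<Sum>k\<in>outer_zeros. 2 * A k / (\<zeta> - \<omega> k))
     + (\<Sum>k\<in>inner_zeros. 2 * cnj (A k) * \<zeta> / (1 - cnj (\<omega> k) * \<zeta>))"

lemma holomorphic_F: "F holomorphic_on cball 0 1"
  unfolding F_def using norm_outer inner_denom_nz
  by (intro holomorphic_intros) force+

text \<open>On the circle the two terms of \<open>D\<close> that belong to \<open>\<omega> k\<close> are complex conjugates of each other, so
  each of them carries half of the real part; \<open>F\<close> selects the one that is analytic in the disk.\<close>
lemma Re_F_circle:
  assumes "cmod \<zeta> = 1"
  shows "Re (F \<zeta>) = q / (cmod (g \<zeta>))\<^sup>2"
proof -
  have "\<zeta> * cnj \<zeta> = 1" using assms by (simp add: complex_norm_square[symmetric])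
  moreover have nz: "\<zeta> \<noteq> 0" using assms by auto
  ultimately have cz: "cnj \<zeta> = 1 / \<zeta>" by (simp add: field_simps)
  have cnj: "cnj (A k / (\<zeta> - \<omega> k)) = cnj (A k) * \<zeta> / (1 - cnj (\<omega> k) * \<zeta>)" for k
  proof -
    have "cnj (\<zeta> - \<omega> k) = (1 - cnj (\<omega> k) * \<zeta>) / \<zeta>"
      using nz by (simp add: cz field_simps)
    then show ?thesis by simp
  qed
  have Re: "Re (cnj (A k) * \<zeta> / (1 - cnj (\<omega> k) * \<zeta>)) = Re (A k / (\<zeta> - \<omega> k))" for k
    unfolding cnj[symmetric] by (rule cnj.sel(1))
  have two: "2 * x / y = x / y + x / y" for x y :: complex
    by (metis add_divide_distrib mult_2)
  have "Re (F \<zeta>) = Re C + (\<Sum>k\<in>outer_zeros. 2 * Re (A k / (\<zeta> - \<omega> k)))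
      + (\<Sum>k\<in>inner_zeros. 2 * Re (cnj (A k) * \<zeta> / (1 - cnj (\<omega> k) * \<zeta>)))"
    unfolding F_def mult.assoc two plus_complex.sel Re_sum Re_complex_of_real by (simp only: mult_2)
  also have "\<dots> = Re C + (\<Sum>k=1..m. 2 * Re (A k / (\<zeta> - \<omega> k)))"
    unfolding Re sum_outer_inner by simp
  also have "\<dots> = Re (D \<zeta>)"
    unfolding D_def plus_complex.sel Re_sum Re by (simp add: sum_distrib_left[symmetric])
  also have "D \<zeta> = h \<zeta>" using h_partial_fractions[OF circle_avoids_poles[OF assms]] by simp
  also have "Re (h \<zeta>) = q / (cmod (g \<zeta>))\<^sup>2" by (simp only: h_circle[OF assms] Re_complex_of_real)
  finally show ?thesis .
qed

lemma poisson_integral_eq: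
  assumes "\<forall>\<zeta>. cmod \<zeta> = 1 \<longrightarrow> f' \<zeta> = g \<zeta>" "\<zeta> \<in> ball 0 1"
  shows "poisson_integral q f' \<zeta> = F \<zeta> - \<i> * of_real (Im (F 0))"
proof -
  have "contour_integral (circlepath 0 1)
      (\<lambda>x. of_real (q / (cmod (f' x))\<^sup>2) * ((x + \<zeta>) / (x - \<zeta>)) / x) =
    2 * of_real pi * \<i> * (F \<zeta> - \<i> * of_real (Im (F 0)))"
  proof (rule schwarz_integral_formula[OF holomorphic_F, where u = "\<lambda>x. q / (cmod (f' x))\<^sup>2"])
    show "q / (cmod (f' x))\<^sup>2 = Re (F x)" if "cmod x = 1" for x
      using assms(1) Re_F_circle that by simp
  qed (use assms(2) in simp)
  then show ?thesis
    unfolding poisson_integral_def by (simp del: of_real_divide)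
qed

text \<open>The explicit \<open>F\<close> shows that a continuation exists, and
  \<open>rational_fun_unique\<close> identifies it. Points of \<open>poisson_poles\<close> are
  excluded because there \<open>F\<close> merely drops its singular term, whereas a fraction in
  lowest terms is 0 at a pole.\<close>

lemma poisson_cont_eq:
  assumes f': "\<forall>\<zeta>. cmod \<zeta> = 1 \<longrightarrow> f' \<zeta> = g \<zeta>" and \<zeta>: "\<zeta> \<notin> poisson_poles"
  shows "poisson_cont q f' \<zeta> = F \<zeta> - \<i> * of_real (Im (F 0))"
proof -
  have "rational_off poisson_poles (\<lambda>\<zeta>. 2 * A k / (\<zeta> - \<omega> k))" if "k \<in> outer_zeros" for k
    using rational_off_mobius[of 1 "- \<omega> k" poisson_poles 0 "2 * A k"] that
    by (simp add: poisson_poles_def)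
  moreover have "rational_off poisson_poles (\<lambda>\<zeta>. 2 * cnj (A k) * \<zeta> / (1 - cnj (\<omega> k) * \<zeta>))"
    if k: "k \<in> inner_zeros" for k
  proof -
    have "\<zeta> \<in> poisson_poles" if "- cnj (\<omega> k) * \<zeta> + 1 = 0" for \<zeta>
      using refl_denom_eq_0_iff[of k \<zeta>] that k by (auto simp: poisson_poles_def inner_zeros_def)
    then show ?thesis
      using rational_off_mobius[of "- cnj (\<omega> k)" 1 poisson_poles "2 * cnj (A k)" 0] by simp
  qed
  ultimately have "rational_off poisson_poles (\<lambda>\<zeta>. F \<zeta> + - \<i> * of_real (Im (F 0)))"
    unfolding F_def by (intro rational_off_add rational_off_sum rational_off_const)
  from rational_off_imp_rational_fun[OF this]
  obtain P where P: "rational_fun P"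
    "\<forall>\<zeta>. \<zeta> \<notin> poisson_poles \<longrightarrow> P \<zeta> = F \<zeta> + - \<i> * of_real (Im (F 0))"
    by (elim exE conjE)
  have Pb: "\<forall>\<zeta>\<in>ball 0 1. P \<zeta> = poisson_integral q f' \<zeta>"
  proof
    fix \<zeta> :: complex assume \<zeta>: "\<zeta> \<in> ball 0 1"
    then have "\<zeta> \<notin> poisson_poles" using ball_avoids_poisson_poles by blast
    then have "P \<zeta> = F \<zeta> - \<i> * of_real (Im (F 0))" using P(2) by simp
    then show "P \<zeta> = poisson_integral q f' \<zeta>"
      by (simp only: poisson_integral_eq[OF f' \<zeta>])
  qed
  have "poisson_cont q f' = P"
    unfolding poisson_cont_def
  proof (rule the_equality)
    fix P' assume P': "rational_fun P' \<and> (\<forall>\<zeta>\<in>ball 0 1. P' \<zeta> = poisson_integral q f' \<zeta>)"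
    show "P' = P"
      by (rule rational_fun_unique) (use P' P(1) Pb in simp_all)
  qed (use P(1) Pb in simp)
  then show ?thesis using P(2) \<zeta> by simp
qed

text \<open>At an \<open>\<omega> k\<close> in the disk the undefined terms of \<open>fun_R\<close> and \<open>Q\<close> are both \<open>0\<close>.\<close>
lemma poisson_cont_plus_R:
  assumes f': "\<forall>\<zeta>. cmod \<zeta> = 1 \<longrightarrow> f' \<zeta> = g \<zeta>" and \<zeta>: "\<zeta> \<notin> poisson_poles"
  shows "poisson_cont q f' \<zeta> + fun_R m A \<omega> \<zeta> = Q \<zeta>"
proof -
  have inner_eq: "{j. j \<in> {1..m} \<and> \<omega> j \<in> ball 0 1} = inner_zeros" by (auto simp: inner_zeros_def)
  define s1 s2 where "s1 = (\<Sum>k\<in>outer_zeros. 2 * A k / \<omega> k)" "s2 = (\<Sum>k\<in>inner_zeros. 2 * A k / \<omega> k)"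
  note s12 = this
  have "F 0 = of_real (Re C) - s1"
    by (simp add: F_def s12 sum_negf)
  moreover have "Im C = Im (s1 + s2)"
    unfolding s12 sum_outer_inner[symmetric] by (simp add: const_C_def)
  \<comment> \<open>The imaginary part of \<open>C\<close> splits in two: the share of the outer
    zeros comes from the normalisation of \<open>P\<close> at 0, the share \<open>s2\<close> of the
    inner zeros is the imaginary constant in \<open>R\<close>.\<close>
  ultimately have "C = of_real (Re C) - \<i> * of_real (Im (F 0)) + \<i> * of_real (Im s2)"
    by (simp add: complex_eq_iff)
  then have "Q \<zeta> = of_real (Re C) - \<i> * of_real (Im (F 0)) + \<i> * of_real (Im s2)
      + ((\<Sum>k\<in>outer_zeros. 2 * A k / (\<zeta> - \<omega> k)) + (\<Sum>k\<in>inner_zeros. 2 * A k / (\<zeta> - \<omega> k)))"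
    unfolding Q_def sum_outer_inner by simp
  moreover have "fun_R m A \<omega> \<zeta> = \<i> * of_real (Im s2) + ((\<Sum>k\<in>inner_zeros. 2 * A k / (\<zeta> - \<omega> k))
      - (\<Sum>k\<in>inner_zeros. 2 * cnj (A k) * \<zeta> / (1 - cnj (\<omega> k) * \<zeta>)))"
    unfolding fun_R_def inner_eq s12 sum_subtractf ..
  moreover have "poisson_cont q f' \<zeta> = of_real (Re C) + (\<Sum>k\<in>outer_zeros. 2 * A k / (\<zeta> - \<omega> k))
     + (\<Sum>k\<in>inner_zeros. 2 * cnj (A k) * \<zeta> / (1 - cnj (\<omega> k) * \<zeta>)) - \<i> * of_real (Im (F 0))"
    unfolding poisson_cont_eq[OF f' \<zeta>] by (simp only: F_def[of \<zeta>])
  ultimately show ?thesis by algebra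
qed

lemma star_poisson_cont_plus_R:
  assumes "\<forall>\<zeta>. cmod \<zeta> = 1 \<longrightarrow> f' \<zeta> = g \<zeta>" "circle_refl \<zeta> \<notin> poisson_poles"
  shows "star (poisson_cont q f') \<zeta> + star (fun_R m A \<omega>) \<zeta> = cnj (Q (circle_refl \<zeta>))"
  using poisson_cont_plus_R[OF assms] by (simp add: star_def circle_refl_def flip: complex_cnj_add)

text \<open>If \<open>\<omega> k\<close> lies in the disk, its reflection belongs to
  \<open>poisson_poles\<close>: the reflected \<open>P\<close> and \<open>R\<close> may each have a
  pole at \<open>\<omega> k\<close>, and only the sum is regular. Hence a limit instead of a
  value.\<close>

lemma tendsto_star_poisson_cont_plus_R:
  assumes f': "\<forall>\<zeta>. cmod \<zeta> = 1 \<longrightarrow> f' \<zeta> = g \<zeta>" and k: "k \<in> {1..m}"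
  shows "((\<lambda>\<zeta>. star (poisson_cont q f') \<zeta> + star (fun_R m A \<omega>) \<zeta>)
    \<longlongrightarrow> cnj (Q (circle_refl (\<omega> k)))) (at (\<omega> k))"
proof (rule Lim_transform_eventually)
  let ?w = "\<omega> k"
  have "((\<lambda>\<zeta>. Q (circle_refl \<zeta>)) \<longlongrightarrow> Q (circle_refl ?w)) (at ?w)"
  proof (rule isCont_tendsto_compose[where g = Q])
    have "circle_refl ?w \<noteq> \<omega> j" if "j \<in> {1..m}" for j
      using zero_neq_refl[OF that k] by auto
    then show "isCont Q (circle_refl ?w)" by (rule isCont_Q)
    show "(circle_refl \<longlongrightarrow> circle_refl ?w) (at ?w)"
      unfolding circle_refl_def using zero_nz[OF k] by (intro tendsto_intros) auto
  qed
  then show "((\<lambda>\<zeta>. cnj (Q (circle_refl \<zeta>))) \<longlongrightarrow> cnj (Q (circle_refl ?w))) (at ?w)"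
    by (intro tendsto_intros)
  have "finite (circle_refl ` poisson_poles)"
    using finite_outer_inner by (simp add: poisson_poles_def)
  then have "\<forall>\<^sub>F \<zeta> in at ?w. \<zeta> \<notin> circle_refl ` poisson_poles"
    by (rule eventually_at_avoids_finite)
  then show "\<forall>\<^sub>F \<zeta> in at ?w. cnj (Q (circle_refl \<zeta>)) =
      star (poisson_cont q f') \<zeta> + star (fun_R m A \<omega>) \<zeta>"
  proof eventually_elim
    case (elim \<zeta>)
    have "\<zeta> = circle_refl (circle_refl \<zeta>)" by (simp add: circle_refl_def)
    then have "circle_refl \<zeta> \<notin> poisson_poles" using elim by blast
    then show ?case using star_poisson_cont_plus_R[OF f'] by simp
  qed
qed

text \<open>The reflection of \<open>z j\<close> lies in the open disk, which contains no point of
  \<open>poisson_poles\<close>, so literal values are available here.\<close>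

lemma star_poisson_cont_plus_R_pole:
  assumes "\<forall>\<zeta>. cmod \<zeta> = 1 \<longrightarrow> f' \<zeta> = g \<zeta>" and j: "j \<in> {1..n}"
  shows "star (poisson_cont q f') (z j) + star (fun_R m A \<omega>) (z j) = cnj (Q (circle_refl (z j)))"
proof -
  have "circle_refl (z j) \<in> ball 0 1"
    using pole_outside[OF j] by (simp add: circle_refl_def norm_divide divide_simps)
  then show ?thesis
    using ball_avoids_poisson_poles by (intro star_poisson_cont_plus_R assms) auto
qed

end

section \<open>Velocities of zeros and poles\<close>

context zero_pole_data begin

text \<open>The logarithmic derivative of \<open>g\<close> with respect to
  \<open>\<zeta>\<close>.\<close>

definition L :: "complex \<Rightarrow> complex" where
  "L \<zeta> = (\<Sum>k=1..m. 1 / (\<zeta> - \<omega> k)) - (\<Sum>j=1..n. 1 / (\<zeta> - z j))"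

definition singularities :: "complex set" where
  "singularities = \<omega> ` {1..m} \<union> z ` {1..n}"

lemma finite_singularities: "finite singularities"
  by (simp add: singularities_def)

text \<open>\<open>\<beta>\<close>, \<open>d\<omega>\<close> and \<open>dz\<close> stand for the
  logarithmic derivative of \<open>b\<close> and the velocities; the identity is the evolution
  equation for \<open>g\<close>, divided by \<open>g\<close>. It is derived in the disk, but the
  poles and infinity lie outside. The complement of a finite set is connected, so the identity
  extends.\<close>

lemma velocity_identity_extend:
  assumes id: "\<And>\<zeta>. \<zeta> \<in> ball 0 1 \<Longrightarrow> \<zeta> \<notin> singularities \<Longrightarrow>
      \<beta> - (\<Sum>k=1..m. d\<omega> k / (\<zeta> - \<omega> k)) + (\<Sum>j=1..n. dz j / (\<zeta> - z j)) =
      Q \<zeta> * (1 + \<zeta> * L \<zeta>) - \<zeta> * (\<Sum>k=1..m. 2 * A k / (\<zeta> - \<omega> k)\<^sup>2)"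
    and \<zeta>: "\<zeta> \<notin> singularities"
  shows "\<beta> - (\<Sum>k=1..m. d\<omega> k / (\<zeta> - \<omega> k)) + (\<Sum>j=1..n. dz j / (\<zeta> - z j)) =
      Q \<zeta> * (1 + \<zeta> * L \<zeta>) - \<zeta> * (\<Sum>k=1..m. 2 * A k / (\<zeta> - \<omega> k)\<^sup>2)"
proof (rule analytic_continuation_open[where s = "ball 0 1 - singularities" and s' = "- singularities"
      and f = "\<lambda>\<zeta>. \<beta> - (\<Sum>k=1..m. d\<omega> k / (\<zeta> - \<omega> k)) + (\<Sum>j=1..n. dz j / (\<zeta> - z j))"
      and g = "\<lambda>\<zeta>. Q \<zeta> * (1 + \<zeta> * L \<zeta>) - \<zeta> * (\<Sum>k=1..m. 2 * A k / (\<zeta> - \<omega> k)\<^sup>2)"])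
  show "open (ball 0 1 - singularities)" "open (- singularities)"
    using finite_singularities by (auto intro!: open_Diff open_Compl finite_imp_closed)
  have "infinite (ball (0::complex) 1)"
    by (simp add: uncountable_ball uncountable_infinite)
  then show "ball 0 1 - singularities \<noteq> {}"
    using finite_singularities by (metis Diff_eq_empty_iff finite_subset)
  show "connected (- singularities)"
    using connected_open_delete_finite[of "UNIV :: complex set" singularities] finite_singularities
    by (simp add: Compl_eq_Diff_UNIV connected_UNIV)
  have nz1: "x - \<omega> k \<noteq> 0" if "x \<in> - singularities" "k \<in> {1..m}" for x k
    using that by (auto simp: singularities_def)
  then have nz3: "(x - \<omega> k)\<^sup>2 \<noteq> 0" if "x \<in> - singularities" "k \<in> {1..m}" for x k
    using that by simp
  have nz2: "x - z j \<noteq> 0" if "x \<in> - singularities" "j \<in> {1..n}" for x j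
    using that by (auto simp: singularities_def)
  show "(\<lambda>\<zeta>. \<beta> - (\<Sum>k=1..m. d\<omega> k / (\<zeta> - \<omega> k)) + (\<Sum>j=1..n. dz j / (\<zeta> - z j)))
      holomorphic_on - singularities"
    by (intro holomorphic_intros nz1 nz2)
  show "(\<lambda>\<zeta>. Q \<zeta> * (1 + \<zeta> * L \<zeta>) - \<zeta> * (\<Sum>k=1..m. 2 * A k / (\<zeta> - \<omega> k)\<^sup>2))
      holomorphic_on - singularities"
    unfolding Q_def L_def by (intro holomorphic_intros nz1 nz2 nz3)
qed (use id \<zeta> in auto)

section \<open>Comparison of residues and of values at infinity\<close>

context
  fixes \<beta> :: complex and d\<omega> dz :: "nat \<Rightarrow> complex"
  assumes id: "\<And>\<zeta>. \<zeta> \<notin> singularities \<Longrightarrow>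
      \<beta> - (\<Sum>k=1..m. d\<omega> k / (\<zeta> - \<omega> k)) + (\<Sum>j=1..n. dz j / (\<zeta> - z j)) =
      Q \<zeta> * (1 + \<zeta> * L \<zeta>) - \<zeta> * (\<Sum>k=1..m. 2 * A k / (\<zeta> - \<omega> k)\<^sup>2)"
begin

lemma tendsto_residue_lhs:
  "((\<lambda>\<zeta>. (\<zeta> - a) * (\<beta> - (\<Sum>k=1..m. d\<omega> k / (\<zeta> - \<omega> k)) + (\<Sum>j=1..n. dz j / (\<zeta> - z j))))
    \<longlongrightarrow> (\<Sum>j | j \<in> {1..n} \<and> z j = a. dz j) - (\<Sum>k | k \<in> {1..m} \<and> \<omega> k = a. d\<omega> k)) (at a)"
proof -
  have "((\<lambda>\<zeta>. (\<zeta> - a) * \<beta> - (\<zeta> - a) * (\<Sum>k=1..m. d\<omega> k / (\<zeta> - \<omega> k))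
       + (\<zeta> - a) * (\<Sum>j=1..n. dz j / (\<zeta> - z j)))
    \<longlongrightarrow> (a - a) * \<beta> - (\<Sum>k | k \<in> {1..m} \<and> \<omega> k = a. d\<omega> k) + (\<Sum>j | j \<in> {1..n} \<and> z j = a. dz j)) (at a)"
    by (intro tendsto_intros tendsto_sum_simple_poles finite_atLeastAtMost)
  then show ?thesis by (simp add: algebra_simps)
qed

lemma eventually_velocity_identity:
  "\<forall>\<^sub>F \<zeta> in at a. (\<zeta> - a) * (\<beta> - (\<Sum>k=1..m. d\<omega> k / (\<zeta> - \<omega> k)) + (\<Sum>j=1..n. dz j / (\<zeta> - z j))) =
     (\<zeta> - a) * (Q \<zeta> * (1 + \<zeta> * L \<zeta>) - \<zeta> * (\<Sum>k=1..m. 2 * A k / (\<zeta> - \<omega> k)\<^sup>2))"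
  using eventually_at_avoids_finite[OF finite_singularities]
proof eventually_elim
  case (elim \<zeta>)
  show ?case unfolding id[OF elim] ..
qed

text \<open>At \<open>\<omega> k\<close> both \<open>Q\<close> and \<open>L\<close> have a simple
  pole. The double pole of their product cancels against the square term of the last sum, and the
  velocity is minus the residue that remains.\<close>

lemma zero_velocity:
  assumes k: "k \<in> {1..m}"
  shows "d\<omega> k / \<omega> k = - C - 2 * A k / \<omega> k
    - (\<Sum>j\<in>{1..m} - {k}. 2 * (A k + A j) / (\<omega> k - \<omega> j)) + (\<Sum>j=1..n. 2 * A k / (\<omega> k - z j))"
proof -
  let ?w = "\<omega> k"
  define q1 where "q1 = (\<lambda>\<zeta>. C + (\<Sum>j\<in>{1..m}-{k}. 2 * A j / (\<zeta> - \<omega> j)))"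
  define s1 where "s1 = (\<lambda>\<zeta>. (\<Sum>j\<in>{1..m}-{k}. 1 / (\<zeta> - \<omega> j)) - (\<Sum>j=1..n. 1 / (\<zeta> - z j)))"
  define t1 where "t1 = (\<lambda>\<zeta>. \<Sum>j\<in>{1..m}-{k}. 2 * A j / (\<zeta> - \<omega> j)\<^sup>2)"
  have nz: "?w - \<omega> j \<noteq> 0" if "j \<in> {1..m} - {k}" for j
    using zero_eq_iff[OF k, of j] that by auto
  have nz2: "?w - z j \<noteq> 0" if "j \<in> {1..n}" for j
    using zero_neq_pole[OF k that] by simp
  have Q1: "Q \<zeta> = q1 \<zeta> + 2 * A k / (\<zeta> - ?w)" for \<zeta>
    unfolding Q_def q1_def using k by (subst sum.remove[of _ k]) auto
  have L1: "L \<zeta> = s1 \<zeta> + 1 / (\<zeta> - ?w)" for \<zeta>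
    unfolding L_def s1_def using k by (subst sum.remove[of _ k]) auto
  have T1: "(\<Sum>k=1..m. 2 * A k / (\<zeta> - \<omega> k)\<^sup>2) = t1 \<zeta> + 2 * A k / (\<zeta> - ?w)\<^sup>2" for \<zeta>
    unfolding t1_def using k by (subst sum.remove[of _ k]) auto
  have "isCont q1 ?w" "isCont s1 ?w" "isCont t1 ?w"
    unfolding q1_def s1_def t1_def using nz nz2 by (auto intro!: continuous_intros)
  then have lims: "(q1 \<longlongrightarrow> q1 ?w) (at ?w)" "(s1 \<longlongrightarrow> s1 ?w) (at ?w)" "(t1 \<longlongrightarrow> t1 ?w) (at ?w)"
    by (simp_all add: isCont_def)
  have "((\<lambda>\<zeta>. 2 * A k + 2 * A k * \<zeta> * s1 \<zeta> + q1 \<zeta> * \<zeta>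
        + (\<zeta> - ?w) * (q1 \<zeta> + q1 \<zeta> * \<zeta> * s1 \<zeta> - \<zeta> * t1 \<zeta>))
      \<longlongrightarrow> 2 * A k + 2 * A k * ?w * s1 ?w + q1 ?w * ?w
        + (?w - ?w) * (q1 ?w + q1 ?w * ?w * s1 ?w - ?w * t1 ?w)) (at ?w)"
    by (intro tendsto_intros lims)
  moreover have "\<forall>\<^sub>F \<zeta> in at ?w. 2 * A k + 2 * A k * \<zeta> * s1 \<zeta> + q1 \<zeta> * \<zeta>
        + (\<zeta> - ?w) * (q1 \<zeta> + q1 \<zeta> * \<zeta> * s1 \<zeta> - \<zeta> * t1 \<zeta>) =
      (\<zeta> - ?w) * (\<beta> - (\<Sum>k=1..m. d\<omega> k / (\<zeta> - \<omega> k)) + (\<Sum>j=1..n. dz j / (\<zeta> - z j)))"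
    using eventually_velocity_identity eventually_neq_at_within[of ?w ?w UNIV]
  proof eventually_elim
    case (elim \<zeta>)
    define u where "u = \<zeta> - ?w"
    have u: "u \<noteq> 0" "\<zeta> = u + ?w" using elim(2) by (auto simp: u_def)
    have "u * ((q1 \<zeta> + 2 * A k / u) * (1 + \<zeta> * (s1 \<zeta> + 1 / u)) - \<zeta> * (t1 \<zeta> + 2 * A k / u\<^sup>2)) =
        2 * A k + 2 * A k * \<zeta> * s1 \<zeta> + q1 \<zeta> * \<zeta>
        + u * (q1 \<zeta> + q1 \<zeta> * \<zeta> * s1 \<zeta> - \<zeta> * t1 \<zeta>)"
      using u(1) by (simp add: field_simps power2_eq_square)
    then show ?case
      unfolding elim(1) Q1 L1 T1 by (simp add: u_def)
  qed
  ultimately have lim: "((\<lambda>\<zeta>. (\<zeta> - ?w) * (\<beta> - (\<Sum>k=1..m. d\<omega> k / (\<zeta> - \<omega> k)) + (\<Sum>j=1..n. dz j / (\<zeta> - z j))))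
      \<longlongrightarrow> 2 * A k + 2 * A k * ?w * s1 ?w + q1 ?w * ?w) (at ?w)"
    by (simp add: Lim_transform_eventually)
  have only: "{i. i \<in> {1..m} \<and> \<omega> i = ?w} = {k}" "{j. j \<in> {1..n} \<and> z j = ?w} = {}"
    using k zero_eq_iff zero_neq_pole[OF k] by force+
  have "- d\<omega> k = 2 * A k + 2 * A k * ?w * s1 ?w + q1 ?w * ?w"
    using tendsto_unique[OF at_neq_bot lim tendsto_residue_lhs] unfolding only by simp
  then have "d\<omega> k / ?w = - (2 * A k + 2 * A k * ?w * s1 ?w + q1 ?w * ?w) / ?w"
    by (metis minus_minus)
  also have "\<dots> = - 2 * A k / ?w - 2 * A k * s1 ?w - q1 ?w"
    using zero_nz[OF k] by (simp add: field_simps)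
  also have "2 * A k * s1 ?w = (\<Sum>j\<in>{1..m}-{k}. 2 * A k / (?w - \<omega> j)) - (\<Sum>j=1..n. 2 * A k / (?w - z j))"
    by (simp add: s1_def right_diff_distrib sum_distrib_left)
  finally show ?thesis
    by (simp add: q1_def distrib_left add_divide_distrib sum.distrib)
qed

text \<open>Near \<open>z j\<close> only \<open>L\<close> is singular on the right, with residue
  minus the multiplicity of the pole. The left side has the sum of the \<open>dz i\<close> over all
  poles at this point.\<close>

lemma pole_velocity_sum:
  assumes j: "j \<in> {1..n}"
  shows "(\<Sum>i | i \<in> {1..n} \<and> z i = z j. dz i) =
    of_nat (card {i \<in> {1..n}. z i = z j}) * (- z j * Q (z j))"
proof -
  let ?a = "z j"
  have a: "?a \<noteq> \<omega> k" if "k \<in> {1..m}" for k using zero_neq_pole[OF that j] by simp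
  have none: "{k. k \<in> {1..m} \<and> \<omega> k = ?a} = {}" using a by force
  have "isCont (\<lambda>\<zeta>. \<Sum>k=1..m. 2 * A k / (\<zeta> - \<omega> k)\<^sup>2) ?a"
    using a by (intro continuous_intros) auto
  then have lims: "(Q \<longlongrightarrow> Q ?a) (at ?a)"
      "((\<lambda>\<zeta>. \<Sum>k=1..m. 2 * A k / (\<zeta> - \<omega> k)\<^sup>2) \<longlongrightarrow> (\<Sum>k=1..m. 2 * A k / (?a - \<omega> k)\<^sup>2)) (at ?a)"
    using isCont_Q[OF a] by (auto simp: isCont_def)
  have "((\<lambda>\<zeta>. (\<zeta> - ?a) * (\<Sum>k=1..m. 1 / (\<zeta> - \<omega> k)) - (\<zeta> - ?a) * (\<Sum>j=1..n. 1 / (\<zeta> - z j)))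
      \<longlongrightarrow> (\<Sum>k | k \<in> {1..m} \<and> \<omega> k = ?a. 1) - (\<Sum>i | i \<in> {1..n} \<and> z i = ?a. 1)) (at ?a)"
    by (intro tendsto_intros tendsto_sum_simple_poles finite_atLeastAtMost)
  then have limL: "((\<lambda>\<zeta>. (\<zeta> - ?a) * L \<zeta>) \<longlongrightarrow> - of_nat (card {i \<in> {1..n}. z i = z j})) (at ?a)"
    unfolding none by (simp add: L_def right_diff_distrib)
  have "((\<lambda>\<zeta>. Q \<zeta> * ((\<zeta> - ?a) + \<zeta> * ((\<zeta> - ?a) * L \<zeta>))
        - (\<zeta> - ?a) * (\<zeta> * (\<Sum>k=1..m. 2 * A k / (\<zeta> - \<omega> k)\<^sup>2)))
      \<longlongrightarrow> Q ?a * ((?a - ?a) + ?a * (- of_nat (card {i \<in> {1..n}. z i = z j})))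
        - (?a - ?a) * (?a * (\<Sum>k=1..m. 2 * A k / (?a - \<omega> k)\<^sup>2))) (at ?a)"
    by (intro tendsto_intros lims limL)
  moreover have "\<forall>\<^sub>F \<zeta> in at ?a. Q \<zeta> * ((\<zeta> - ?a) + \<zeta> * ((\<zeta> - ?a) * L \<zeta>))
        - (\<zeta> - ?a) * (\<zeta> * (\<Sum>k=1..m. 2 * A k / (\<zeta> - \<omega> k)\<^sup>2)) =
      (\<zeta> - ?a) * (\<beta> - (\<Sum>k=1..m. d\<omega> k / (\<zeta> - \<omega> k)) + (\<Sum>j=1..n. dz j / (\<zeta> - z j)))"
    using eventually_velocity_identity
  proof eventually_elim
    case (elim \<zeta>)
    show ?case unfolding elim(1) by algebra
  qed
  ultimately have "((\<lambda>\<zeta>. (\<zeta> - ?a) * (\<beta> - (\<Sum>k=1..m. d\<omega> k / (\<zeta> - \<omega> k)) + (\<Sum>j=1..n. dz j / (\<zeta> - z j))))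
      \<longlongrightarrow> Q ?a * ((?a - ?a) + ?a * (- of_nat (card {i \<in> {1..n}. z i = z j})))
        - (?a - ?a) * (?a * (\<Sum>k=1..m. 2 * A k / (?a - \<omega> k)\<^sup>2))) (at ?a)"
    by (rule Lim_transform_eventually)
  from tendsto_unique[OF at_neq_bot tendsto_residue_lhs this] show ?thesis
    unfolding none by (simp add: mult_ac)
qed

text \<open>At infinity \<open>Q\<close> tends to \<open>C\<close> and
  \<open>\<zeta> * L \<zeta>\<close> to \<open>m - n\<close>, while all sums with decaying terms
  vanish.\<close>

lemma leading_coeff_velocity: "\<beta> = of_nat (m - n + 1) * C"
proof -
  have sum0: "((\<lambda>\<zeta>. \<Sum>i=1..N. c i / (\<zeta> - a i)) \<longlongrightarrow> 0) at_infinity" for N and c a :: "nat \<Rightarrow> complex"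
  proof -
    have "((\<lambda>\<zeta>. \<Sum>i=1..N. c i / (\<zeta> - a i)) \<longlongrightarrow> (\<Sum>i=1..N. 0)) at_infinity"
      by (intro tendsto_intros tendsto_inverse_shift_infinity)
    then show ?thesis by simp
  qed
  have sum1: "((\<lambda>\<zeta>. \<zeta> * (\<Sum>i=1..N. 1 / (\<zeta> - a i))) \<longlongrightarrow> of_nat N) at_infinity" for N and a :: "nat \<Rightarrow> complex"
  proof -
    have "((\<lambda>\<zeta>. \<Sum>i=1..N. \<zeta> / (\<zeta> - a i)) \<longlongrightarrow> (\<Sum>i=1..N. 1)) at_infinity"
      by (intro tendsto_intros tendsto_ratio_infinity)
    then show ?thesis by (simp add: sum_distrib_left)
  qed
  have sum2: "((\<lambda>\<zeta>. \<zeta> * (\<Sum>k=1..m. 2 * A k / (\<zeta> - \<omega> k)\<^sup>2)) \<longlongrightarrow> 0) at_infinity"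
  proof -
    have "((\<lambda>\<zeta>. \<Sum>k=1..m. \<zeta> / (\<zeta> - \<omega> k) * (2 * A k / (\<zeta> - \<omega> k))) \<longlongrightarrow> (\<Sum>k=1..m. 1 * 0)) at_infinity"
      by (intro tendsto_intros tendsto_ratio_infinity tendsto_inverse_shift_infinity)
    then show ?thesis by (simp add: sum_distrib_left power2_eq_square)
  qed
  have "((\<lambda>\<zeta>. (C + (\<Sum>k=1..m. 2 * A k / (\<zeta> - \<omega> k))) *
        (1 + (\<zeta> * (\<Sum>k=1..m. 1 / (\<zeta> - \<omega> k)) - \<zeta> * (\<Sum>j=1..n. 1 / (\<zeta> - z j))))
        - \<zeta> * (\<Sum>k=1..m. 2 * A k / (\<zeta> - \<omega> k)\<^sup>2))
      \<longlongrightarrow> (C + 0) * (1 + (of_nat m - of_nat n)) - 0) at_infinity"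
    by (intro tendsto_intros sum0 sum1 sum2)
  moreover have "\<forall>\<^sub>F \<zeta> in at_infinity. (C + (\<Sum>k=1..m. 2 * A k / (\<zeta> - \<omega> k))) *
        (1 + (\<zeta> * (\<Sum>k=1..m. 1 / (\<zeta> - \<omega> k)) - \<zeta> * (\<Sum>j=1..n. 1 / (\<zeta> - z j))))
        - \<zeta> * (\<Sum>k=1..m. 2 * A k / (\<zeta> - \<omega> k)\<^sup>2) =
      \<beta> - (\<Sum>k=1..m. d\<omega> k / (\<zeta> - \<omega> k)) + (\<Sum>j=1..n. dz j / (\<zeta> - z j))"
  proof -
    have "bounded singularities" using finite_singularities by (rule finite_imp_bounded)
    then obtain B where B: "\<And>x. x \<in> singularities \<Longrightarrow> norm x \<le> B"
      unfolding bounded_iff by blast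
    have "\<forall>\<^sub>F \<zeta> in at_infinity. \<zeta> \<notin> singularities"
      unfolding eventually_at_infinity by (rule exI[of _ "B + 1"]) (use B in force)
    then show ?thesis
    proof eventually_elim
      case (elim \<zeta>)
      show ?case unfolding id[OF elim] Q_def L_def right_diff_distrib ..
    qed
  qed
  ultimately have 1: "((\<lambda>\<zeta>. \<beta> - (\<Sum>k=1..m. d\<omega> k / (\<zeta> - \<omega> k)) + (\<Sum>j=1..n. dz j / (\<zeta> - z j)))
      \<longlongrightarrow> (C + 0) * (1 + (of_nat m - of_nat n)) - 0) at_infinity"
    by (rule Lim_transform_eventually)
  have 2: "((\<lambda>\<zeta>. \<beta> - (\<Sum>k=1..m. d\<omega> k / (\<zeta> - \<omega> k)) + (\<Sum>j=1..n. dz j / (\<zeta> - z j)))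
      \<longlongrightarrow> \<beta> - 0 + 0) at_infinity"
    by (intro tendsto_intros sum0)
  show ?thesis
    using tendsto_unique[OF trivial_limit_at_infinity 2 1] n_le_m
    by (simp add: of_nat_diff mult_ac add_ac)
qed

end

end

text \<open>\<open>G - G 0\<close> will be the time derivative of \<open>f\<close>, and
  \<open>g\<^sub>t\<close> that of \<open>g\<close>. Differentiating \<open>G_eq\<close> in the disk
  gives two expressions for \<open>g\<^sub>t\<close>, and division by \<open>g\<close> is possible
  away from the singularities.\<close>

lemma (in zero_pole_data) velocity_identity_of_primitive:
  assumes G: "\<And>\<zeta>. \<zeta> \<in> ball 0 1 \<Longrightarrow> (G has_field_derivative g\<^sub>t \<zeta>) (at \<zeta>)"
    and G_eq: "\<And>\<zeta>. \<zeta> \<in> ball 0 1 \<Longrightarrow> \<zeta> \<notin> \<omega> ` {1..m} \<Longrightarrow> G \<zeta> - G 0 = \<zeta> * g \<zeta> * Q \<zeta>"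
    and g\<^sub>t: "\<And>\<zeta>. \<zeta> \<notin> singularities \<Longrightarrow>
      g\<^sub>t \<zeta> = g \<zeta> * (\<beta> - (\<Sum>k=1..m. d\<omega> k / (\<zeta> - \<omega> k)) + (\<Sum>j=1..n. dz j / (\<zeta> - z j)))"
    and \<zeta>: "\<zeta> \<notin> singularities"
  shows "\<beta> - (\<Sum>k=1..m. d\<omega> k / (\<zeta> - \<omega> k)) + (\<Sum>j=1..n. dz j / (\<zeta> - z j)) =
    Q \<zeta> * (1 + \<zeta> * L \<zeta>) - \<zeta> * (\<Sum>k=1..m. 2 * A k / (\<zeta> - \<omega> k)\<^sup>2)"
proof (rule velocity_identity_extend[OF _ \<zeta>])
  fix \<zeta> :: complex
  assume \<zeta>: "\<zeta> \<in> ball 0 1" "\<zeta> \<notin> singularities"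
  have nz: "\<zeta> - \<omega> k \<noteq> 0" if "k \<in> {1..m}" for k
    using \<zeta>(2) that by (auto simp: singularities_def)
  have nz2: "\<zeta> - z j \<noteq> 0" if "j \<in> {1..n}" for j
    using \<zeta>(2) that by (auto simp: singularities_def)
  have g_nz: "g \<zeta> \<noteq> 0"
    using b_nz nz nz2 by (simp add: rational_g_def)
  have lin: "((\<lambda>\<zeta>. \<Prod>i=1..N. \<zeta> - a i) has_field_derivative
      (\<Prod>i=1..N. \<zeta> - a i) * (\<Sum>i=1..N. 1 / (\<zeta> - a i))) (at \<zeta>)"
    if "\<And>i. i \<in> {1..N} \<Longrightarrow> \<zeta> - a i \<noteq> 0" for N and a :: "nat \<Rightarrow> complex"
    using that by (intro has_field_derivative_prod') (auto intro!: derivative_eq_intros)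
  have dg: "(g has_field_derivative g \<zeta> * L \<zeta>) (at \<zeta>)"
  proof -
    define p1 p2 where "p1 = (\<Prod>k=1..m. \<zeta> - \<omega> k)" "p2 = (\<Prod>j=1..n. \<zeta> - z j)"
    note p = this
    have "p2 \<noteq> 0" using nz2 by (simp add: p)
    have "((\<lambda>\<zeta>. b * (\<Prod>k=1..m. \<zeta> - \<omega> k) / (\<Prod>j=1..n. \<zeta> - z j)) has_field_derivative
       (b * (p1 * (\<Sum>i=1..m. 1 / (\<zeta> - \<omega> i))) * p2 - b * p1 * (p2 * (\<Sum>i=1..n. 1 / (\<zeta> - z i)))) / (p2 * p2))
       (at \<zeta>)"
      unfolding p
      by (intro DERIV_divide DERIV_cmult lin nz nz2) (use nz2 in auto)
    also have "(b * (p1 * (\<Sum>i=1..m. 1 / (\<zeta> - \<omega> i))) * p2 - b * p1 * (p2 * (\<Sum>i=1..n. 1 / (\<zeta> - z i)))) / (p2 * p2) =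
        g \<zeta> * L \<zeta>"
      using \<open>p2 \<noteq> 0\<close> unfolding L_def rational_g_def p[symmetric] by (simp add: field_simps)
    finally show ?thesis unfolding rational_g_def[abs_def] .
  qed
  have dQ: "(Q has_field_derivative - (\<Sum>k=1..m. 2 * A k / (\<zeta> - \<omega> k)\<^sup>2)) (at \<zeta>)"
  proof -
    have "((\<lambda>\<zeta>. C + (\<Sum>k=1..m. 2 * A k / (\<zeta> - \<omega> k))) has_field_derivative
        0 + (\<Sum>k=1..m. - (2 * A k / (\<zeta> - \<omega> k)\<^sup>2))) (at \<zeta>)"
    proof (intro DERIV_add DERIV_const DERIV_sum)
      fix k assume "k \<in> {1..m}"
      then show "((\<lambda>\<zeta>. 2 * A k / (\<zeta> - \<omega> k)) has_field_derivative - (2 * A k / (\<zeta> - \<omega> k)\<^sup>2)) (at \<zeta>)"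
        using nz by (auto intro!: derivative_eq_intros simp: power2_eq_square)
    qed
    then show ?thesis unfolding Q_def[abs_def] by (simp add: sum_negf)
  qed
  have "((\<lambda>\<zeta>. \<zeta> * (g \<zeta> * Q \<zeta>)) has_field_derivative
      1 * (g \<zeta> * Q \<zeta>) + (g \<zeta> * L \<zeta> * Q \<zeta> + - (\<Sum>k=1..m. 2 * A k / (\<zeta> - \<omega> k)\<^sup>2) * g \<zeta>) * \<zeta>) (at \<zeta>)"
    by (intro DERIV_mult DERIV_ident dg dQ)
  then have "((\<lambda>\<zeta>. G \<zeta> - G 0) has_field_derivative
      1 * (g \<zeta> * Q \<zeta>) + (g \<zeta> * L \<zeta> * Q \<zeta> + - (\<Sum>k=1..m. 2 * A k / (\<zeta> - \<omega> k)\<^sup>2) * g \<zeta>) * \<zeta>) (at \<zeta>)"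
  proof (rule has_field_derivative_transform_within_open)
    show "open (ball 0 1 - \<omega> ` {1..m})"
      by (intro open_Diff finite_imp_closed) auto
    show "\<zeta> \<in> ball 0 1 - \<omega> ` {1..m}"
      using \<zeta> by (auto simp: singularities_def)
  qed (use G_eq in \<open>auto simp: mult.assoc\<close>)
  moreover have "((\<lambda>\<zeta>. G \<zeta> - G 0) has_field_derivative g\<^sub>t \<zeta> - 0) (at \<zeta>)"
    by (intro DERIV_diff DERIV_const G \<zeta>)
  ultimately have "g\<^sub>t \<zeta> - 0 =
      1 * (g \<zeta> * Q \<zeta>) + (g \<zeta> * L \<zeta> * Q \<zeta> + - (\<Sum>k=1..m. 2 * A k / (\<zeta> - \<omega> k)\<^sup>2) * g \<zeta>) * \<zeta>"
    by (rule DERIV_unique[symmetric])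
  also have "\<dots> = g \<zeta> * (Q \<zeta> * (1 + \<zeta> * L \<zeta>) - \<zeta> * (\<Sum>k=1..m. 2 * A k / (\<zeta> - \<omega> k)\<^sup>2))"
    by algebra
  finally have "g \<zeta> * (\<beta> - (\<Sum>k=1..m. d\<omega> k / (\<zeta> - \<omega> k)) + (\<Sum>j=1..n. dz j / (\<zeta> - z j))) = \<dots>"
    unfolding g\<^sub>t[OF \<zeta>(2)] by simp
  then show "\<beta> - (\<Sum>k=1..m. d\<omega> k / (\<zeta> - \<omega> k)) + (\<Sum>j=1..n. dz j / (\<zeta> - z j)) =
    Q \<zeta> * (1 + \<zeta> * L \<zeta>) - \<zeta> * (\<Sum>k=1..m. 2 * A k / (\<zeta> - \<omega> k)\<^sup>2)"
    using g_nz by (simp only: mult_cancel_left simp_thms)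
qed

section \<open>Differentiation in time\<close>

lemma smooth_in_time_C1:
  assumes "smooth_in_time I h"
  shows "\<exists>h'. (\<forall>t\<in>I. (h has_vector_derivative h' t) (at t within I)) \<and>
    continuous_on I h \<and> continuous_on I h'"
proof -
  obtain D where D: "D 0 = h" "\<And>n t. t \<in> I \<Longrightarrow> (D n has_vector_derivative D (Suc n) t) (at t within I)"
    using assms unfolding smooth_in_time_def by blast
  have "continuous_on I (D n)" for n
    using D(2) by (rule continuous_on_vector_derivative)
  then show ?thesis using D(2)[of _ 0] D(1) by (intro exI[of _ "D 1"]) auto
qed

text \<open>A nondegenerate interval has no isolated points, so one-sided derivatives at its end
  points are unique as well.\<close>

lemma at_within_interval_neq_bot:
  fixes I :: "real set"
  assumes "is_interval I" "interior I \<noteq> {}" "t \<in> I"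
  shows "at t within I \<noteq> bot"
proof -
  have "I \<noteq> {t}" using assms(2) by auto
  then have "t islimpt I"
    using connected_imp_perfect assms(1,3) is_interval_connected by blast
  then show ?thesis by (simp add: trivial_limit_within)
qed

lemma has_vector_derivative_prod:
  fixes f :: "'i \<Rightarrow> real \<Rightarrow> 'a :: real_normed_field"
  assumes "\<And>i. i \<in> S \<Longrightarrow> (f i has_vector_derivative f' i) (at t within I)"
  shows "((\<lambda>s. \<Prod>i\<in>S. f i s) has_vector_derivative (\<Sum>i\<in>S. f' i * (\<Prod>j\<in>S - {i}. f j t))) (at t within I)"
proof -
  have "((\<lambda>s. \<Prod>i\<in>S. f i s) has_derivative
      (\<lambda>y. \<Sum>i\<in>S. y *\<^sub>R f' i * (\<Prod>j\<in>S - {i}. f j t))) (at t within I)"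
    using assms unfolding has_vector_derivative_def by (rule has_derivative_prod)
  then show ?thesis
    unfolding has_vector_derivative_def by (simp add: scaleR_sum_right)
qed

text \<open>Integration along a radius, parametrised by a fixed real interval: the form to which the
  Leibniz rule applies.\<close>

lemma has_integral_radial:
  fixes F :: "complex \<Rightarrow> complex"
  assumes F: "\<And>w. w \<in> ball 0 1 \<Longrightarrow> (F has_field_derivative F' w) (at w)" and \<zeta>: "\<zeta> \<in> ball 0 1"
  shows "((\<lambda>s. \<zeta> * F' (of_real s * \<zeta>)) has_integral (F \<zeta> - F 0)) {0..1}"
proof -
  have "((\<lambda>s. \<zeta> * F' (of_real s * \<zeta>)) has_integral (F (of_real 1 * \<zeta>) - F (of_real 0 * \<zeta>))) {0..1}"
  proof (rule fundamental_theorem_of_calculus)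
    fix s :: real assume s: "s \<in> {0..1}"
    have "s * cmod \<zeta> \<le> 1 * cmod \<zeta>" using s by (intro mult_right_mono) auto
    then have "of_real s * \<zeta> \<in> ball 0 1" using \<zeta> s by (simp add: norm_mult)
    then have "(F has_field_derivative F' (of_real s * \<zeta>)) (at (of_real s * \<zeta>) within (\<lambda>s. of_real s * \<zeta>) ` {0..1})"
      by (rule has_field_derivative_at_within[OF F])
    moreover have "((\<lambda>s. of_real s * \<zeta>) has_vector_derivative \<zeta>) (at s within {0..1})"
      unfolding scaleR_conv_of_real[symmetric] has_vector_derivative_def
      by (auto intro!: derivative_eq_intros)
    ultimately have "((F \<circ> (\<lambda>s. of_real s * \<zeta>)) has_vector_derivative \<zeta> * F' (of_real s * \<zeta>)) (at s within {0..1})"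
      by (intro field_vector_diff_chain_within)
    then show "((\<lambda>s. F (of_real s * \<zeta>)) has_vector_derivative \<zeta> * F' (of_real s * \<zeta>)) (at s within {0..1})"
      by (simp add: o_def)
  qed simp
  then show ?thesis by simp
qed

text \<open>The time derivative of \<open>rational_g\<close> from the product rule. No factor
  \<open>\<zeta> - \<omega> k\<close> is divided out, so the expression is also valid and
  holomorphic at zeros inside the disk.\<close>

definition rational_g_deriv ::
  "nat \<Rightarrow> nat \<Rightarrow> complex \<Rightarrow> (nat \<Rightarrow> complex) \<Rightarrow> (nat \<Rightarrow> complex) \<Rightarrow>
    complex \<Rightarrow> (nat \<Rightarrow> complex) \<Rightarrow> (nat \<Rightarrow> complex) \<Rightarrow> complex \<Rightarrow> complex" where
  "rational_g_deriv m n b \<omega> z b' \<omega>' z' \<zeta> =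
     b' * (\<Prod>k=1..m. \<zeta> - \<omega> k) * (\<Prod>j=1..n. inverse (\<zeta> - z j))
     + b * (\<Sum>k=1..m. - \<omega>' k * (\<Prod>i\<in>{1..m} - {k}. \<zeta> - \<omega> i)) * (\<Prod>j=1..n. inverse (\<zeta> - z j))
     + b * (\<Prod>k=1..m. \<zeta> - \<omega> k) * (\<Sum>j=1..n. z' j / (\<zeta> - z j)\<^sup>2 * (\<Prod>i\<in>{1..n} - {j}. inverse (\<zeta> - z i)))"

lemma rational_g_inverse:
  "rational_g m n b \<omega> z \<zeta> = b * (\<Prod>k=1..m. \<zeta> - \<omega> k) * (\<Prod>j=1..n. inverse (\<zeta> - z j))"
  by (simp only: rational_g_def prod_inversef[symmetric] divide_inverse o_def)

lemma has_vector_derivative_rational_g: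
  assumes b: "(b has_vector_derivative b') (at t within I)"
    and \<omega>: "\<And>k. k \<in> {1..m} \<Longrightarrow> (\<omega> k has_vector_derivative \<omega>' k) (at t within I)"
    and z: "\<And>j. j \<in> {1..n} \<Longrightarrow> (z j has_vector_derivative z' j) (at t within I)"
    and nz: "\<And>j. j \<in> {1..n} \<Longrightarrow> \<zeta> \<noteq> z j t"
  shows "((\<lambda>s. rational_g m n (b s) (\<lambda>k. \<omega> k s) (\<lambda>j. z j s) \<zeta>) has_vector_derivative
    rational_g_deriv m n (b t) (\<lambda>k. \<omega> k t) (\<lambda>j. z j t) b' \<omega>' z' \<zeta>) (at t within I)"
proof -
  have 1: "((\<lambda>s. \<Prod>k=1..m. \<zeta> - \<omega> k s) has_vector_derivative
      (\<Sum>k=1..m. - \<omega>' k * (\<Prod>i\<in>{1..m} - {k}. \<zeta> - \<omega> i t))) (at t within I)"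
  proof (rule has_vector_derivative_prod)
    fix k assume "k \<in> {1..m}"
    then show "((\<lambda>s. \<zeta> - \<omega> k s) has_vector_derivative - \<omega>' k) (at t within I)"
      using has_vector_derivative_diff[OF has_vector_derivative_const \<omega>] by simp
  qed
  have 2: "((\<lambda>s. \<Prod>j=1..n. inverse (\<zeta> - z j s)) has_vector_derivative
      (\<Sum>j=1..n. z' j / (\<zeta> - z j t)\<^sup>2 * (\<Prod>i\<in>{1..n} - {j}. inverse (\<zeta> - z i t)))) (at t within I)"
  proof (rule has_vector_derivative_prod)
    fix j assume j: "j \<in> {1..n}"
    have "((\<lambda>w. inverse (\<zeta> - w)) has_field_derivative 1 / (\<zeta> - z j t)\<^sup>2) (at (z j t) within z j ` I)"
      using nz[OF j] by (auto intro!: derivative_eq_intros simp: power2_eq_square divide_simps)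
    from field_vector_diff_chain_within[OF z[OF j] this]
    show "((\<lambda>s. inverse (\<zeta> - z j s)) has_vector_derivative z' j / (\<zeta> - z j t)\<^sup>2) (at t within I)"
      by (simp add: o_def)
  qed
  have "((\<lambda>s. b s * (\<Prod>k=1..m. \<zeta> - \<omega> k s) * (\<Prod>j=1..n. inverse (\<zeta> - z j s))) has_vector_derivative
    b t * (\<Prod>k=1..m. \<zeta> - \<omega> k t) *
      (\<Sum>j=1..n. z' j / (\<zeta> - z j t)\<^sup>2 * (\<Prod>i\<in>{1..n} - {j}. inverse (\<zeta> - z i t)))
    + (b t * (\<Sum>k=1..m. - \<omega>' k * (\<Prod>i\<in>{1..m} - {k}. \<zeta> - \<omega> i t)) + b' * (\<Prod>k=1..m. \<zeta> - \<omega> k t))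
      * (\<Prod>j=1..n. inverse (\<zeta> - z j t))) (at t within I)"
    by (intro has_vector_derivative_mult b 1 2)
  then show ?thesis
    unfolding rational_g_inverse rational_g_deriv_def by (simp only: algebra_simps)
qed

lemma rational_g_deriv_eq:
  assumes "b \<noteq> 0" "\<And>k. k \<in> {1..m} \<Longrightarrow> \<zeta> \<noteq> \<omega> k" "\<And>j. j \<in> {1..n} \<Longrightarrow> \<zeta> \<noteq> z j"
  shows "rational_g_deriv m n b \<omega> z b' \<omega>' z' \<zeta> = rational_g m n b \<omega> z \<zeta> *
    (b' / b - (\<Sum>k=1..m. \<omega>' k / (\<zeta> - \<omega> k)) + (\<Sum>j=1..n. z' j / (\<zeta> - z j)))"
proof -
  define N V where "N = (\<Prod>k=1..m. \<zeta> - \<omega> k)" "V = (\<Prod>j=1..n. inverse (\<zeta> - z j))"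
  note NV = this
  have 1: "(\<Sum>k=1..m. - \<omega>' k * (\<Prod>i\<in>{1..m} - {k}. \<zeta> - \<omega> i)) = N * - (\<Sum>k=1..m. \<omega>' k / (\<zeta> - \<omega> k))"
    unfolding sum_negf[symmetric] sum_distrib_left
  proof (rule sum.cong)
    fix k assume k: "k \<in> {1..m}"
    have "N = (\<zeta> - \<omega> k) * (\<Prod>i\<in>{1..m} - {k}. \<zeta> - \<omega> i)"
      unfolding NV using k by (subst prod.remove[of _ k]) auto
    then show "- \<omega>' k * (\<Prod>i\<in>{1..m} - {k}. \<zeta> - \<omega> i) = N * - (\<omega>' k / (\<zeta> - \<omega> k))"
      using assms(2)[OF k] by simp
  qed simp
  have 2: "(\<Sum>j=1..n. z' j / (\<zeta> - z j)\<^sup>2 * (\<Prod>i\<in>{1..n} - {j}. inverse (\<zeta> - z i))) =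
      V * (\<Sum>j=1..n. z' j / (\<zeta> - z j))"
    unfolding sum_distrib_left
  proof (rule sum.cong)
    fix j assume j: "j \<in> {1..n}"
    have "V = inverse (\<zeta> - z j) * (\<Prod>i\<in>{1..n} - {j}. inverse (\<zeta> - z i))"
      unfolding NV using j by (subst prod.remove[of _ j]) auto
    then show "z' j / (\<zeta> - z j)\<^sup>2 * (\<Prod>i\<in>{1..n} - {j}. inverse (\<zeta> - z i)) = V * (z' j / (\<zeta> - z j))"
      by (simp add: power2_eq_square divide_inverse)
  qed simp
  have "b' * N * V + b * (N * - s) * V + b * N * (V * u) = b * N * V * (b' / b - s + u)" for s u
    using assms(1) by (simp add: field_simps)
  then show ?thesis
    unfolding rational_g_deriv_def rational_g_inverse 1 2 NV[symmetric] .
qed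

section \<open>Colliding poles\<close>

lemma eventually_neq_of_vector_derivative:
  fixes d :: "real \<Rightarrow> 'a :: real_normed_vector"
  assumes "(d has_vector_derivative d') (at t within I)" "d' \<noteq> 0"
  shows "\<forall>\<^sub>F s in at t within I. d s \<noteq> d t"
proof -
  have "((\<lambda>s. (1 / norm (s - t)) *\<^sub>R (d s - (d t + (s - t) *\<^sub>R d'))) \<longlongrightarrow> 0) (at t within I)"
    using assms(1) unfolding has_vector_derivative_def has_derivative_within by simp
  then have "\<forall>\<^sub>F s in at t within I. norm ((1 / norm (s - t)) *\<^sub>R (d s - (d t + (s - t) *\<^sub>R d'))) < norm d'"
    using assms(2) by (auto dest!: tendstoD[where e = "norm d'"] simp del: norm_scaleR)
  then show ?thesis
    using eventually_neq_at_within[of t t I]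
  proof eventually_elim
    case (elim s)
    show ?case
    proof
      assume "d s = d t"
      \<comment> \<open>If \<open>d\<close> returned to its value at \<open>t\<close>, the
        normalised remainder would have norm exactly \<open>norm d'\<close>, although it tends to
        0.\<close>
      then have "norm ((1 / norm (s - t)) *\<^sub>R (d s - (d t + (s - t) *\<^sub>R d'))) = norm d'"
        using elim(2) by (simp add: divide_simps)
      then show False using elim(1) by simp
    qed
  qed
qed

text \<open>Where points collide, only the sum of their velocities is given. Near a time \<open>t\<close> of collision, the
  points that meet \<open>z j\<close> are among those with the same position and velocity as \<open>z j\<close> at \<open>t\<close>, so the
  mean velocity of each such cluster tends to \<open>z' j t\<close>.\<close>
lemma velocity_of_cluster_mean:
  fixes z z' :: "'i \<Rightarrow> real \<Rightarrow> 'a :: real_normed_field"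
  assumes N: "finite N" "j \<in> N" and t: "t \<in> I" "at t within I \<noteq> bot"
    and z: "\<And>i. i \<in> N \<Longrightarrow> (z i has_vector_derivative z' i t) (at t within I)"
    and z': "\<And>i. i \<in> N \<Longrightarrow> continuous_on I (z' i)" and V: "continuous_on I V"
    and mean: "\<And>s. s \<in> I \<Longrightarrow>
      (\<Sum>i | i \<in> N \<and> z i s = z j s. z' i s) = of_nat (card {i \<in> N. z i s = z j s}) * V s"
  shows "z' j t = V t"
proof -
  define K where "K = {i \<in> N. z i t = z j t \<and> z' i t = z' j t}"
  have "\<forall>\<^sub>F s in at t within I. z i s \<noteq> z j s" if i: "i \<in> N - K" for i
  proof (cases "z i t = z j t")
    case True
    then have "z' i t - z' j t \<noteq> 0" using i by (auto simp: K_def)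
    moreover have "((\<lambda>s. z i s - z j s) has_vector_derivative z' i t - z' j t) (at t within I)"
      using i N(2) by (intro has_vector_derivative_diff z) auto
    ultimately have "\<forall>\<^sub>F s in at t within I. z i s - z j s \<noteq> z i t - z j t"
      by (rule eventually_neq_of_vector_derivative[rotated])
    then show ?thesis by eventually_elim (use True in auto)
  next
    case False
    have "continuous (at t within I) (z i)" "continuous (at t within I) (z j)"
      using z i N(2) by (auto intro!: has_vector_derivative_continuous)
    then have "((\<lambda>s. z i s - z j s) \<longlongrightarrow> z i t - z j t) (at t within I)"
      by (intro tendsto_intros) (simp_all add: continuous_within)
    then have "\<forall>\<^sub>F s in at t within I. z i s - z j s \<noteq> 0"
      using False by (intro tendsto_imp_eventually_ne) auto
    then show ?thesis by eventually_elim auto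
  qed
  then have "\<forall>\<^sub>F s in at t within I. \<forall>i\<in>N - K. z i s \<noteq> z j s"
    using N(1) by (intro eventually_ball_finite) auto
  moreover have "\<forall>\<^sub>F s in at t within I. s \<in> I"
    by (simp add: eventually_at_filter)
  ultimately have le: "\<forall>\<^sub>F s in at t within I. norm (V s - z' j t) \<le> (\<Sum>i\<in>K. norm (z' i s - z' i t))"
  proof eventually_elim
    case (elim s)
    \<comment> \<open>The cluster at time \<open>s\<close>. It contains \<open>j\<close>, so
      \<open>card M\<close> is at least 1, and lies in \<open>K\<close>, where all velocities at
      \<open>t\<close> equal \<open>z' j t\<close>. This bounds the deviation of the mean by terms
      that are small by continuity.\<close>
    define M where "M = {i \<in> N. z i s = z j s}"
    have M: "M \<subseteq> K" "finite K" "card M > 0"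
      using elim(1) N by (auto simp: M_def K_def card_gt_0_iff)
    have "of_nat (card M) * (V s - z' j t) = (\<Sum>i\<in>M. z' i s - z' j t)"
      using mean[OF elim(2)] by (simp add: M_def right_diff_distrib sum_subtractf)
    also have "\<dots> = (\<Sum>i\<in>M. z' i s - z' i t)"
      using M(1) by (intro sum.cong) (auto simp: K_def)
    finally have "of_nat (card M) * norm (V s - z' j t) = norm (\<Sum>i\<in>M. z' i s - z' i t)"
      by (metis norm_mult norm_of_nat)
    also have "\<dots> \<le> (\<Sum>i\<in>M. norm (z' i s - z' i t))"
      by (rule norm_sum)
    also have "\<dots> \<le> (\<Sum>i\<in>K. norm (z' i s - z' i t))"
      using M by (intro sum_mono2) auto
    finally have "of_nat (card M) * norm (V s - z' j t) \<le> (\<Sum>i\<in>K. norm (z' i s - z' i t))" .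
    moreover have "1 * norm (V s - z' j t) \<le> of_nat (card M) * norm (V s - z' j t)"
      using M(3) by (intro mult_right_mono) auto
    ultimately show ?case by linarith
  qed
  have "(V \<longlongrightarrow> V t) (at t within I)"
    using V t(1) by (simp add: continuous_on)
  then have lim1: "((\<lambda>s. norm (V s - z' j t)) \<longlongrightarrow> norm (V t - z' j t)) (at t within I)"
    by (intro tendsto_intros)
  have "(z' i \<longlongrightarrow> z' i t) (at t within I)" if "i \<in> K" for i
    using z'[of i, unfolded continuous_on] that t(1) unfolding K_def by blast
  then have "((\<lambda>s. \<Sum>i\<in>K. norm (z' i s - z' i t)) \<longlongrightarrow> (\<Sum>i\<in>K. norm (z' i t - z' i t))) (at t within I)"
    by (intro tendsto_intros)
  from tendsto_le[OF t(2) this lim1 le] show ?thesis by simp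
qed

text \<open>Smoothness of \<open>f\<close> in \<open>t\<close> is available only for each fixed
  point, which does not by itself permit interchanging the derivatives in time and space. As a
  radial integral of \<open>g\<close>, whose time derivative is jointly continuous, \<open>f\<close>
  can be differentiated under the integral sign; \<open>f0\<close> removes the integration
  constant.\<close>

lemma time_deriv_eq_primitive:
  fixes f g g\<^sub>t :: "real \<Rightarrow> complex \<Rightarrow> complex"
  assumes I: "is_interval I" "interior I \<noteq> {}" and t: "t \<in> I"
    and f: "\<And>s w. s \<in> I \<Longrightarrow> w \<in> ball 0 1 \<Longrightarrow> (f s has_field_derivative g s w) (at w)"
    and f0: "\<And>s. s \<in> I \<Longrightarrow> f s 0 = 0"
    and g: "\<And>s w. s \<in> I \<Longrightarrow> w \<in> ball 0 1 \<Longrightarrow> ((\<lambda>s. g s w) has_vector_derivative g\<^sub>t s w) (at s within I)"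
    and cont: "continuous_on (I \<times> ball 0 1) (\<lambda>(s, w). g\<^sub>t s w)"
    and holo: "g\<^sub>t t holomorphic_on ball 0 1"
  shows "\<exists>G. \<forall>w\<in>ball 0 1. (G has_field_derivative g\<^sub>t t w) (at w) \<and>
    time_deriv I (\<lambda>s. f s w) t = G w - G 0"
proof -
  obtain G where G: "\<And>w. w \<in> ball 0 1 \<Longrightarrow> (G has_field_derivative g\<^sub>t t w) (at w within ball 0 1)"
    using holomorphic_convex_primitive'[OF convex_ball open_ball holo] by blast
  then have G': "(G has_field_derivative g\<^sub>t t w) (at w)" if "w \<in> ball 0 1" for w
    using that at_within_open[OF that open_ball] by metis
  have "time_deriv I (\<lambda>s. f s w) t = G w - G 0" if w: "w \<in> ball 0 1" for w
  proof -
    have in_ball: "of_real x * w \<in> ball 0 1" if "x \<in> {0..1}" for x :: real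
    proof -
      have "x * cmod w \<le> 1 * cmod w" using that by (intro mult_right_mono) auto
      then show ?thesis using w that by (simp add: norm_mult)
    qed
    have f_int: "((\<lambda>x. w * g s (of_real x * w)) has_integral f s w) (cbox 0 1)" if "s \<in> I" for s
      using has_integral_radial[OF f[OF that] w] f0[OF that] by simp
    have "((\<lambda>s. integral (cbox 0 1) (\<lambda>x. w * g s (of_real x * w))) has_vector_derivative
        integral (cbox 0 1) (\<lambda>x. w * g\<^sub>t t (of_real x * w))) (at t within I)"
    proof (rule leibniz_rule_vector_derivative)
      fix s x :: real assume "s \<in> I" "x \<in> cbox 0 1"
      then show "((\<lambda>s. w * g s (of_real x * w)) has_vector_derivative w * g\<^sub>t s (of_real x * w)) (at s within I)"
        using g in_ball by (intro has_vector_derivative_mult_right) auto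
    next
      fix s assume "s \<in> I"
      then show "(\<lambda>x. w * g s (of_real x * w)) integrable_on cbox 0 1"
        using f_int by blast
    next
      have "continuous_on (I \<times> cbox 0 1) (\<lambda>p. (\<lambda>(s, w). g\<^sub>t s w) (fst p, of_real (snd p) * w))"
        by (rule continuous_on_compose2[OF cont]) (use in_ball in \<open>auto intro!: continuous_intros\<close>)
      then show "continuous_on (I \<times> cbox 0 1) (\<lambda>(s, x). w * g\<^sub>t s (of_real x * w))"
        by (auto simp: split_beta intro!: continuous_intros)
    next
      show "convex I" using I(1) by (simp add: is_interval_convex)
    qed (use t in auto)
    also have "integral (cbox 0 1) (\<lambda>x. w * g\<^sub>t t (of_real x * w)) = G w - G 0"
      using has_integral_radial[OF G' w] unfolding box_real(2)[symmetric] by (rule integral_unique)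
    finally have "((\<lambda>s. f s w) has_vector_derivative G w - G 0) (at t within I)"
    proof (rule has_vector_derivative_transform[OF t, rotated])
      fix s assume "s \<in> I"
      then show "f s w = integral (cbox 0 1) (\<lambda>x. w * g s (of_real x * w))"
        by (rule integral_unique[OF f_int, symmetric])
    qed
    then show ?thesis
      unfolding time_deriv_def
      by (rule vector_derivative_within[OF at_within_interval_neq_bot[OF I t]])
  qed
  then show ?thesis using G' by blast
qed

lemma holomorphic_rational_g_deriv:
  assumes "\<And>j w. j \<in> {1..n} \<Longrightarrow> w \<in> S \<Longrightarrow> w \<noteq> z j"
  shows "rational_g_deriv m n b \<omega> z b' \<omega>' z' holomorphic_on S"
  unfolding rational_g_deriv_def using assms
  by (intro holomorphic_intros) auto

lemma continuous_on_rational_g_deriv: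
  fixes b b' :: "real \<Rightarrow> complex" and \<omega> \<omega>' z z' :: "nat \<Rightarrow> real \<Rightarrow> complex"
  assumes "continuous_on I b" "continuous_on I b'"
    "\<And>k. k \<in> {1..m} \<Longrightarrow> continuous_on I (\<omega> k)" "\<And>k. k \<in> {1..m} \<Longrightarrow> continuous_on I (\<omega>' k)"
    "\<And>j. j \<in> {1..n} \<Longrightarrow> continuous_on I (z j)" "\<And>j. j \<in> {1..n} \<Longrightarrow> continuous_on I (z' j)"
    and nz: "\<And>t j w. t \<in> I \<Longrightarrow> j \<in> {1..n} \<Longrightarrow> w \<in> S \<Longrightarrow> w \<noteq> z j t"
  shows "continuous_on (I \<times> S) (\<lambda>(t, w). rational_g_deriv m n (b t) (\<lambda>k. \<omega> k t) (\<lambda>j. z j t)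
    (b' t) (\<lambda>k. \<omega>' k t) (\<lambda>j. z' j t) w)"
proof -
  have fst: "continuous_on (I \<times> S) (\<lambda>p. h (fst p))" if "continuous_on I h" for h :: "real \<Rightarrow> complex"
    by (rule continuous_on_compose2[OF that]) (auto intro: continuous_intros)
  show ?thesis
    unfolding rational_g_deriv_def split_beta
    by (intro continuous_intros fst assms) (use nz in auto)
qed

section \<open>Agreement of the two forms of the velocity of a zero\<close>

context zero_pole_data begin

text \<open>This is \<open>Q_add_reflect_zero\<close> solved for the reflected value of
  \<open>Q\<close>. The two sums over \<open>1 - cnj a * \<omega> k\<close> stem from the
  logarithmic derivative of \<open>star g\<close>.\<close>

lemma zero_velocity_rhs_eq:
  assumes k: "k \<in> {1..m}" and nz: "\<And>j. j \<in> {1..n} \<Longrightarrow> \<omega> k \<noteq> circle_refl (z j)"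
  shows "- C - 2 * A k / \<omega> k - (\<Sum>j\<in>{1..m} - {k}. 2 * (A k + A j) / (\<omega> k - \<omega> j))
      + (\<Sum>j=1..n. 2 * A k / (\<omega> k - z j)) =
    cnj (Q (circle_refl (\<omega> k))) - 2 * A k / \<omega> k * (1 + (\<Sum>j=1..m. 1 / (1 - cnj (\<omega> j) * \<omega> k))
      - (\<Sum>j=1..n. 1 / (1 - cnj (z j) * \<omega> k)))"
proof -
  have "(\<Sum>j\<in>{1..m} - {k}. 2 * (A k + A j) / (\<omega> k - \<omega> j)) =
      2 * A k * (\<Sum>j\<in>{1..m} - {k}. 1 / (\<omega> k - \<omega> j)) + (\<Sum>j\<in>{1..m} - {k}. 2 * A j / (\<omega> k - \<omega> j))"
    by (simp add: sum_distrib_left add_divide_distrib distrib_left sum.distrib)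
  moreover have "(\<Sum>j=1..n. 2 * A k / (\<omega> k - z j)) = 2 * A k * (\<Sum>j=1..n. 1 / (\<omega> k - z j))"
    by (simp add: sum_distrib_left)
  moreover have "- C - a / w - (a * s2 + sj) + a * s1 = l - a / w * (1 + u - v)"
    if "C + sj + l = a * (s1 - v / w - s2 + u / w)" for w a s1 s2 sj u v l
  proof -
    have l: "l = a * (s1 - v / w - s2 + u / w) - C - sj"
      using that by (simp add: algebra_simps)
    show ?thesis unfolding l by (simp add: algebra_simps diff_divide_distrib add_divide_distrib)
  qed
  ultimately show ?thesis using Q_add_reflect_zero[OF k nz] by simp
qed

end

text \<open>The second form for \<open>\<omega> k\<close> uses a limit because the reflected
  \<open>P\<close> and \<open>R\<close> may have poles there that cancel. If
  \<open>\<omega> k\<close> is the reflection of a pole, then \<open>A k = 0\<close> meets a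
  vanishing denominator in the last sum, and the product has no literal meaning. The second form for
  \<open>z j\<close> leaves out simple poles at the reflection of a zero, where \<open>h\<close>
  does not vanish unless \<open>q\<close> does.\<close>

theorem theorem9p1:
  fixes I :: "real set"
    and f :: "real \<Rightarrow> complex \<Rightarrow> complex"
    and g :: "real \<Rightarrow> complex \<Rightarrow> complex"
    and m n :: nat
    and b :: "real \<Rightarrow> complex"
    and \<omega> z :: "nat \<Rightarrow> real \<Rightarrow> complex"
    and q :: "real \<Rightarrow> real"
    and Ainf C :: "real \<Rightarrow> complex"
    and A :: "nat \<Rightarrow> real \<Rightarrow> complex"
    and P R :: "real \<Rightarrow> complex \<Rightarrow> complex"
  assumes I: "is_interval I" "interior I \<noteq> {}"
    and f_norm: "\<And>t. t \<in> I \<Longrightarrow> f t \<in> O_norm"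
    and f_smooth: "\<And>\<zeta>. \<zeta> \<in> cball 0 1 \<Longrightarrow> smooth_in_time I (\<lambda>t. f t \<zeta>)"
    and b_smooth: "smooth_in_time I b"
    and \<omega>_smooth: "\<And>k. k \<in> {1..m} \<Longrightarrow> smooth_in_time I (\<omega> k)"
    and z_smooth: "\<And>j. j \<in> {1..n} \<Longrightarrow> smooth_in_time I (z j)"
    and g_eq: "g = (\<lambda>t. rational_g m n (b t) (\<lambda>k. \<omega> k t) (\<lambda>j. z j t))"
    and f'_eq_g: "\<And>t \<zeta>. t \<in> I \<Longrightarrow> \<zeta> \<in> cball 0 1 \<Longrightarrow> deriv (f t) \<zeta> = g t \<zeta>"
    and mn: "m \<ge> n"
    and poles_outside: "\<And>t j. t \<in> I \<Longrightarrow> j \<in> {1..n} \<Longrightarrow> cmod (z j t) > 1"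
    and zeros_not_poles:
      "\<And>t k j. t \<in> I \<Longrightarrow> k \<in> {1..m} \<Longrightarrow> j \<in> {1..n} \<Longrightarrow> \<omega> k t \<noteq> z j t"
    and simple_zeros: "\<And>t. t \<in> I \<Longrightarrow> inj_on (\<lambda>k. \<omega> k t) {1..m}"
    and no_common_zeros:
      "\<And>t k j. t \<in> I \<Longrightarrow> k \<in> {1..m} \<Longrightarrow> j \<in> {1..m} \<Longrightarrow> \<omega> k t \<noteq> circle_refl (\<omega> j t)"
    and Ainf_eq: "Ainf = (\<lambda>t. coef_A_inf (q t) (g t))"
    and A_eq: "A = (\<lambda>k t. coef_A (q t) (g t) (\<omega> k t))"
    and C_eq: "C = (\<lambda>t. const_C m (Ainf t) (\<lambda>k. A k t) (\<lambda>k. \<omega> k t))"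
    and P_eq: "P = (\<lambda>t. poisson_cont (q t) (deriv (f t)))"
    and R_eq: "R = (\<lambda>t. fun_R m (\<lambda>j. A j t) (\<lambda>j. \<omega> j t))"
    and PG: "polubarinova_galin I f q"
    and PG_form:
      "\<And>t \<zeta>. t \<in> I \<Longrightarrow> \<zeta> \<in> ball 0 1 \<Longrightarrow> \<zeta> \<notin> (\<lambda>k. \<omega> k t) ` {1..m} \<Longrightarrow>
         time_deriv I (\<lambda>s. f s \<zeta>) t = \<zeta> * deriv (f t) \<zeta> * (P t \<zeta> + R t \<zeta>)"
  shows "\<forall>t\<in>I.
     ((\<lambda>\<zeta>. complex_of_real (q t) / (g t \<zeta> * star (g t) \<zeta>)) \<longlongrightarrow> Ainf t) at_infinity \<and>
     Ainf t =
       (if m = n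
        then complex_of_real (q t) * (\<Prod>j=1..n. cnj (z j t))
             / (complex_of_real ((cmod (b t))\<^sup>2) * (\<Prod>j=1..m. cnj (\<omega> j t)))
        else 0) \<and>
     (\<forall>k\<in>{1..m}.
        A k t =
          complex_of_real (q t / (cmod (b t))\<^sup>2) *
          (((\<Prod>j=1..n. \<omega> k t - z j t) * (\<Prod>j=1..n. cnj (circle_refl (\<omega> k t) - z j t)))
           / ((\<Prod>j\<in>{1..m} - {k}. \<omega> k t - \<omega> j t)
              * (\<Prod>j=1..m. cnj (circle_refl (\<omega> k t) - \<omega> j t))))) \<and>
     (\<forall>k\<in>{1..m}.
        log_time_deriv I (\<omega> k) t =
          - C t - 2 * A k t / \<omega> k t
          - (\<Sum>j\<in>{1..m} - {k}. 2 * (A k t + A j t) / (\<omega> k t - \<omega> j t))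
          + (\<Sum>j=1..n. 2 * A k t / (\<omega> k t - z j t))) \<and>
     (\<forall>k\<in>{1..m}. (\<forall>j\<in>{1..n}. \<omega> k t \<noteq> circle_refl (z j t)) \<longrightarrow>
        (\<exists>L. ((\<lambda>\<zeta>. star (P t) \<zeta> + star (R t) \<zeta>) \<longlongrightarrow> L) (at (\<omega> k t)) \<and>
          log_time_deriv I (\<omega> k) t =
            L - 2 * A k t / \<omega> k t *
                (1 + (\<Sum>j=1..m. 1 / (1 - cnj (\<omega> j t) * \<omega> k t))
                   - (\<Sum>j=1..n. 1 / (1 - cnj (z j t) * \<omega> k t))))) \<and>
     (\<forall>j\<in>{1..n}.
        log_time_deriv I (z j) t = - C t - (\<Sum>k=1..m. 2 * A k t / (z j t - \<omega> k t))) \<and>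
     (\<forall>j\<in>{1..n}.
        (\<forall>k\<in>{1..m}. z j t \<noteq> circle_refl (\<omega> k t)) \<or> (\<exists>i\<in>{1..n} - {j}. z i t = z j t) \<longrightarrow>
        log_time_deriv I (z j) t = star (P t) (z j t) + star (R t) (z j t)) \<and>
     log_time_deriv I b t = of_nat (m - n + 1) * C t"
proof -
  have bot: "at t within I \<noteq> bot" if "t \<in> I" for t
    using at_within_interval_neq_bot[OF I that] .
  obtain b' where b': "\<And>t. t \<in> I \<Longrightarrow> (b has_vector_derivative b' t) (at t within I)"
    "continuous_on I b" "continuous_on I b'"
    using smooth_in_time_C1[OF b_smooth] by blast
  have "\<forall>k\<in>{1..m}. \<exists>h'. (\<forall>t\<in>I. (\<omega> k has_vector_derivative h' t) (at t within I)) \<and>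
      continuous_on I (\<omega> k) \<and> continuous_on I h'"
    by (intro ballI smooth_in_time_C1 \<omega>_smooth)
  then obtain \<omega>' where \<omega>': "\<forall>k\<in>{1..m}. (\<forall>t\<in>I. (\<omega> k has_vector_derivative \<omega>' k t) (at t within I)) \<and>
      continuous_on I (\<omega> k) \<and> continuous_on I (\<omega>' k)"
    by (rule bchoice[THEN exE])
  have "\<forall>j\<in>{1..n}. \<exists>h'. (\<forall>t\<in>I. (z j has_vector_derivative h' t) (at t within I)) \<and>
      continuous_on I (z j) \<and> continuous_on I h'"
    by (intro ballI smooth_in_time_C1 z_smooth)
  then obtain z' where z': "\<forall>j\<in>{1..n}. (\<forall>t\<in>I. (z j has_vector_derivative z' j t) (at t within I)) \<and>
      continuous_on I (z j) \<and> continuous_on I (z' j)"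
    by (rule bchoice[THEN exE])
  have log: "log_time_deriv I h t = h' / h t"
    if "t \<in> I" "(h has_vector_derivative h') (at t within I)" for h h' t
    unfolding log_time_deriv_def time_deriv_def using vector_derivative_within[OF bot that(2)] that(1) by simp
  have data: "zero_pole_data m n (b t) (\<lambda>k. \<omega> k t) (\<lambda>j. z j t)" if t: "t \<in> I" for t
  proof
    \<comment> \<open>The value at 0 is the positive derivative of \<open>f\<close> there; it rules
      out \<open>b = 0\<close> and zeros at the origin.\<close>
    have "g t 0 \<noteq> 0"
      using f_norm[OF t] f'_eq_g[OF t, of 0] by (auto simp: O_norm_def)
    then show "b t \<noteq> 0" "\<And>k. k \<in> {1..m} \<Longrightarrow> \<omega> k t \<noteq> 0"
      unfolding g_eq rational_g_def by (auto simp: prod_zero_iff)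
  qed (use t mn poles_outside zeros_not_poles simple_zeros no_common_zeros in auto)
  \<comment> \<open>\<open>V\<close> is \<open>Q\<close> with its dependence on \<open>t\<close>
    explicit, as required for continuity in time.\<close>
  define V where "V = (\<lambda>t \<zeta>. C t + (\<Sum>k=1..m. 2 * A k t / (\<zeta> - \<omega> k t)))"
  note coef = A_eq Ainf_eq C_eq g_eq

  have key: "(\<forall>k\<in>{1..m}. \<omega>' k t / \<omega> k t = - C t - 2 * A k t / \<omega> k t
          - (\<Sum>j\<in>{1..m} - {k}. 2 * (A k t + A j t) / (\<omega> k t - \<omega> j t))
          + (\<Sum>j=1..n. 2 * A k t / (\<omega> k t - z j t))) \<and>
      (\<forall>j\<in>{1..n}. (\<Sum>i | i \<in> {1..n} \<and> z i t = z j t. z' i t) =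
          of_nat (card {i \<in> {1..n}. z i t = z j t}) * (- z j t * V t (z j t))) \<and>
      b' t / b t = of_nat (m - n + 1) * C t" if t: "t \<in> I" for t
  proof -
    interpret Z: zero_pole_data m n "b t" "\<lambda>k. \<omega> k t" "\<lambda>j. z j t" "q t"
      by (rule data[OF t])
    define g\<^sub>t where "g\<^sub>t = (\<lambda>t. rational_g_deriv m n (b t) (\<lambda>k. \<omega> k t) (\<lambda>j. z j t)
      (b' t) (\<lambda>k. \<omega>' k t) (\<lambda>j. z' j t))"
    have nz: "w \<noteq> z j s" if "s \<in> I" "j \<in> {1..n}" "w \<in> ball 0 1" for s j w
      using poles_outside[OF that(1,2)] that(3) by auto
    have "\<exists>G. \<forall>w\<in>ball 0 1. (G has_field_derivative g\<^sub>t t w) (at w) \<and>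
      time_deriv I (\<lambda>s. f s w) t = G w - G 0"
    proof (rule time_deriv_eq_primitive[OF I t, of f g g\<^sub>t])
      fix s w assume s: "s \<in> I" and w: "w \<in> ball (0::complex) 1"
      have "f s analytic_on cball 0 1" using f_norm[OF s] by (simp add: O_norm_def)
      then have "f s field_differentiable at w"
        using w by (meson analytic_on_imp_differentiable_at ball_subset_cball subsetD)
      then have "(f s has_field_derivative deriv (f s) w) (at w)"
        by (simp only: DERIV_deriv_iff_field_differentiable)
      also have "deriv (f s) w = g s w"
        using f'_eq_g[OF s, of w] w by simp
      finally show "(f s has_field_derivative g s w) (at w)" .
      show "((\<lambda>s. g s w) has_vector_derivative g\<^sub>t s w) (at s within I)"
        unfolding g_eq g\<^sub>t_def using s w b' \<omega>' z' nz
        by (intro has_vector_derivative_rational_g) auto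
    next
      show "f s 0 = 0" if "s \<in> I" for s
        using f_norm[OF that] by (simp add: O_norm_def)
      show "continuous_on (I \<times> ball 0 1) (\<lambda>(s, w). g\<^sub>t s w)"
        unfolding g\<^sub>t_def using b' \<omega>' z' nz
        by (intro continuous_on_rational_g_deriv) auto
      show "g\<^sub>t t holomorphic_on ball 0 1"
        unfolding g\<^sub>t_def using nz[OF t] by (intro holomorphic_rational_g_deriv) auto
    qed
    then obtain G where G: "\<And>w. w \<in> ball 0 1 \<Longrightarrow> (G has_field_derivative g\<^sub>t t w) (at w)"
      "\<And>w. w \<in> ball 0 1 \<Longrightarrow> time_deriv I (\<lambda>s. f s w) t = G w - G 0"
      by blast
    have circle: "\<forall>\<zeta>. cmod \<zeta> = 1 \<longrightarrow> deriv (f t) \<zeta> = Z.g \<zeta>"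
      using f'_eq_g[OF t] by (simp add: g_eq)
    have G_eq: "G w - G 0 = w * Z.g w * Z.Q w"
      if "w \<in> ball 0 1" "w \<notin> (\<lambda>k. \<omega> k t) ` {1..m}" for w
    proof -
      have "P t w + R t w = Z.Q w"
        using Z.poisson_cont_plus_R[OF circle, of w] that(1) Z.ball_avoids_poisson_poles
        unfolding P_eq R_eq coef by blast
      then show ?thesis
        using PG_form[OF t that] G(2)[OF that(1)] f'_eq_g[OF t, of w] that(1) by (simp add: g_eq)
    qed
    have id: "b' t / b t - (\<Sum>k=1..m. \<omega>' k t / (\<zeta> - \<omega> k t)) + (\<Sum>j=1..n. z' j t / (\<zeta> - z j t)) =
      Z.Q \<zeta> * (1 + \<zeta> * Z.L \<zeta>) - \<zeta> * (\<Sum>k=1..m. 2 * Z.A k / (\<zeta> - \<omega> k t)\<^sup>2)"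
      if "\<zeta> \<notin> Z.singularities" for \<zeta>
    proof (rule Z.velocity_identity_of_primitive[OF G(1) G_eq _ that])
      fix \<zeta> assume "\<zeta> \<notin> Z.singularities"
      then show "g\<^sub>t t \<zeta> = Z.g \<zeta> *
        (b' t / b t - (\<Sum>k=1..m. \<omega>' k t / (\<zeta> - \<omega> k t)) + (\<Sum>j=1..n. z' j t / (\<zeta> - z j t)))"
        unfolding g\<^sub>t_def using Z.b_nz
        by (intro rational_g_deriv_eq) (auto simp: Z.singularities_def)
    qed
    show ?thesis
      using Z.zero_velocity[OF id] Z.pole_velocity_sum[OF id] Z.leading_coeff_velocity[OF id]
      unfolding V_def Z.Q_def coef by blast
  qed

  \<comment> \<open>The boundary equation at the point 1 expresses \<open>q\<close> through the time
    derivative of \<open>f\<close> and the value of \<open>g\<close> there, both continuous in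
    \<open>t\<close>.\<close>
  have contq: "continuous_on I q"
  proof -
    obtain h' where h': "\<And>t. t \<in> I \<Longrightarrow> ((\<lambda>t. f t 1) has_vector_derivative h' t) (at t within I)" "continuous_on I h'"
      using smooth_in_time_C1[OF f_smooth[of 1]] by auto
    have "q t = Re (h' t * cnj (rational_g m n (b t) (\<lambda>k. \<omega> k t) (\<lambda>j. z j t) 1))" if t: "t \<in> I" for t
    proof -
      have "time_deriv I (\<lambda>s. f s 1) t = h' t"
        unfolding time_deriv_def using vector_derivative_within[OF bot h'(1)] t by simp
      then show ?thesis
        using PG[unfolded polubarinova_galin_def, rule_format, OF t, of 1] f'_eq_g[OF t, of 1]
        by (simp add: g_eq)
    qed
    moreover have "continuous_on I (\<lambda>t. Re (h' t * cnj (rational_g m n (b t) (\<lambda>k. \<omega> k t) (\<lambda>j. z j t) 1)))"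
      unfolding rational_g_def using h'(2) b' \<omega>' z' poles_outside
      by (intro continuous_intros) force+
    ultimately show ?thesis by (simp cong: continuous_on_cong)
  qed
  \<comment> \<open>In the formula for \<open>H\<close> no denominator vanishes on \<open>I\<close>,
    even at times when \<open>\<omega> k\<close> is the reflection of a pole and
    \<open>star g\<close> has a default value.\<close>
  have contA: "continuous_on I (A k)" if k: "k \<in> {1..m}" for k
  proof -
    have "A k t = zero_pole_data.H m n (b t) (\<lambda>k. \<omega> k t) (\<lambda>j. z j t) (q t) k (\<omega> k t)" if t: "t \<in> I" for t
      unfolding coef by (rule zero_pole_data.A_eq_H[OF data[OF t] k])
    moreover have "continuous_on I (\<lambda>t. zero_pole_data.H m n (b t) (\<lambda>k. \<omega> k t) (\<lambda>j. z j t) (q t) k (\<omega> k t))"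
    proof -
      have nz: "b t \<noteq> 0" "\<omega> k t \<noteq> 0" "\<And>j. j \<in> {1..m} \<Longrightarrow> 1 / \<omega> k t - cnj (\<omega> j t) \<noteq> 0"
        "\<And>j. j \<in> {1..m} - {k} \<Longrightarrow> \<omega> k t - \<omega> j t \<noteq> 0" if t: "t \<in> I" for t
      proof -
        interpret Z: zero_pole_data m n "b t" "\<lambda>k. \<omega> k t" "\<lambda>j. z j t" "q t"
          by (rule data[OF t])
        show "b t \<noteq> 0" "\<omega> k t \<noteq> 0" by (rule Z.b_nz, rule Z.zero_nz[OF k])
        show "1 / \<omega> k t - cnj (\<omega> j t) \<noteq> 0" if "j \<in> {1..m}" for j
          by (rule Z.inverse_minus_cnj_zero_nz[OF k that])
        show "\<omega> k t - \<omega> j t \<noteq> 0" if "j \<in> {1..m} - {k}" for j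
          using Z.zero_eq_iff[OF k, of j] that by auto
      qed
      have "continuous_on I (\<lambda>t. complex_of_real (q t / (cmod (b t))\<^sup>2) *
         (((\<Prod>j=1..n. \<omega> k t - z j t) * (\<Prod>j=1..n. 1 / \<omega> k t - cnj (z j t)))
          / ((\<Prod>j\<in>{1..m} - {k}. \<omega> k t - \<omega> j t) * (\<Prod>j=1..m. 1 / \<omega> k t - cnj (\<omega> j t)))))"
        using b'(2) \<omega>' z' contq k nz by (intro continuous_intros) auto
      then show ?thesis
        by (rule continuous_on_eq) (simp only: zero_pole_data.H_def[OF data])
    qed
    ultimately show ?thesis by (simp cong: continuous_on_cong)
  qed
  have contC: "continuous_on I C"
  proof -
    have "Ainf t = (if m = n then of_real (q t) * (\<Prod>j=1..n. cnj (z j t))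
             / (of_real ((cmod (b t))\<^sup>2) * (\<Prod>j=1..m. cnj (\<omega> j t))) else 0)" if t: "t \<in> I" for t
      unfolding coef by (rule zero_pole_data.A_inf_eq[OF data[OF t]])
    moreover have nz: "b t \<noteq> 0" "k \<in> {1..m} \<Longrightarrow> \<omega> k t \<noteq> 0" if "t \<in> I" for t k
      using zero_pole_data.b_nz[OF data[OF that]] zero_pole_data.zero_nz[OF data[OF that]] by auto
    then have "continuous_on I (\<lambda>t. if m = n then of_real (q t) * (\<Prod>j=1..n. cnj (z j t))
             / (of_real ((cmod (b t))\<^sup>2) * (\<Prod>j=1..m. cnj (\<omega> j t))) else 0)"
      using b'(2) \<omega>' z' contq by (cases "m = n") (auto intro!: continuous_intros)
    ultimately have "continuous_on I Ainf" by (simp cong: continuous_on_cong)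
    then show ?thesis
      unfolding C_eq const_C_def using contA \<omega>' nz
      by (intro continuous_intros) auto
  qed
  have z_log: "z' j t / z j t = - V t (z j t)" if t: "t \<in> I" and j: "j \<in> {1..n}" for t j
  proof -
    have "z' j t = - z j t * V t (z j t)"
    \<comment> \<open>The residues give the cluster sums at every time in \<open>I\<close>. Since
      the candidate velocity is continuous along \<open>z j\<close>, the mean value argument
      isolates the velocity of this one pole.\<close>
    proof (rule velocity_of_cluster_mean[of "{1..n}" j t I z z' "\<lambda>t. - z j t * V t (z j t)"])
      show "continuous_on I (\<lambda>t. - z j t * V t (z j t))"
        unfolding V_def using contC contA z' \<omega>' j zeros_not_poles
        by (intro continuous_intros) force+
    qed (use key z' j t bot in auto)
    moreover have "z j t \<noteq> 0" using poles_outside[OF t j] by auto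
    ultimately show ?thesis by simp
  qed

  show ?thesis
  proof (intro ballI conjI)
    fix t assume t: "t \<in> I"
    interpret Z: zero_pole_data m n "b t" "\<lambda>k. \<omega> k t" "\<lambda>j. z j t" "q t"
      by (rule data[OF t])
    have circle: "\<forall>\<zeta>. cmod \<zeta> = 1 \<longrightarrow> deriv (f t) \<zeta> = Z.g \<zeta>"
      using f'_eq_g[OF t] by (simp add: g_eq)
    show "((\<lambda>\<zeta>. complex_of_real (q t) / (g t \<zeta> * star (g t) \<zeta>)) \<longlongrightarrow> Ainf t) at_infinity"
      using Z.tendsto_A_inf unfolding Z.h_def[abs_def] coef .
    show "Ainf t = (if m = n then complex_of_real (q t) * (\<Prod>j=1..n. cnj (z j t))
             / (complex_of_real ((cmod (b t))\<^sup>2) * (\<Prod>j=1..m. cnj (\<omega> j t))) else 0)"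
      unfolding coef by (rule Z.A_inf_eq)
    show "A k t = complex_of_real (q t / (cmod (b t))\<^sup>2) *
          (((\<Prod>j=1..n. \<omega> k t - z j t) * (\<Prod>j=1..n. cnj (circle_refl (\<omega> k t) - z j t)))
           / ((\<Prod>j\<in>{1..m} - {k}. \<omega> k t - \<omega> j t)
              * (\<Prod>j=1..m. cnj (circle_refl (\<omega> k t) - \<omega> j t))))" if "k \<in> {1..m}" for k
      unfolding coef by (rule Z.A_eq[OF that])
    show \<omega>_log: "log_time_deriv I (\<omega> k) t = - C t - 2 * A k t / \<omega> k t
          - (\<Sum>j\<in>{1..m} - {k}. 2 * (A k t + A j t) / (\<omega> k t - \<omega> j t))
          + (\<Sum>j=1..n. 2 * A k t / (\<omega> k t - z j t))" if "k \<in> {1..m}" for k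
      using log[OF t, of "\<omega> k" "\<omega>' k t"] \<omega>' key[OF t] t that by simp
    have lim: "((\<lambda>\<zeta>. star (P t) \<zeta> + star (R t) \<zeta>) \<longlongrightarrow> cnj (Z.Q (circle_refl (\<omega> k t)))) (at (\<omega> k t))"
      if "k \<in> {1..m}" for k
      using Z.tendsto_star_poisson_cont_plus_R[OF circle that] unfolding P_eq R_eq coef .
    show "(\<forall>j\<in>{1..n}. \<omega> k t \<noteq> circle_refl (z j t)) \<longrightarrow>
        (\<exists>L. ((\<lambda>\<zeta>. star (P t) \<zeta> + star (R t) \<zeta>) \<longlongrightarrow> L) (at (\<omega> k t)) \<and>
          log_time_deriv I (\<omega> k) t =
            L - 2 * A k t / \<omega> k t *
                (1 + (\<Sum>j=1..m. 1 / (1 - cnj (\<omega> j t) * \<omega> k t))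
                   - (\<Sum>j=1..n. 1 / (1 - cnj (z j t) * \<omega> k t))))" if k: "k \<in> {1..m}" for k
    proof (intro impI exI conjI)
      assume "\<forall>j\<in>{1..n}. \<omega> k t \<noteq> circle_refl (z j t)"
      then show "log_time_deriv I (\<omega> k) t = cnj (Z.Q (circle_refl (\<omega> k t))) - 2 * A k t / \<omega> k t *
                (1 + (\<Sum>j=1..m. 1 / (1 - cnj (\<omega> j t) * \<omega> k t))
                   - (\<Sum>j=1..n. 1 / (1 - cnj (z j t) * \<omega> k t)))"
        using Z.zero_velocity_rhs_eq[OF k] unfolding \<omega>_log[OF k] coef by blast
    qed (rule lim[OF k])
    have z_log': "log_time_deriv I (z j) t = - V t (z j t)" if "j \<in> {1..n}" for j
      using log[OF t, of "z j" "z' j t"] z' z_log[OF t] t that by simp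
    show "log_time_deriv I (z j) t = - C t - (\<Sum>k=1..m. 2 * A k t / (z j t - \<omega> k t))"
      if "j \<in> {1..n}" for j
      using z_log'[OF that] by (simp add: V_def)
    show "(\<forall>k\<in>{1..m}. z j t \<noteq> circle_refl (\<omega> k t)) \<or> (\<exists>i\<in>{1..n} - {j}. z i t = z j t) \<longrightarrow>
        log_time_deriv I (z j) t = star (P t) (z j t) + star (R t) (z j t)" if j: "j \<in> {1..n}" for j
    proof
      assume "(\<forall>k\<in>{1..m}. z j t \<noteq> circle_refl (\<omega> k t)) \<or> (\<exists>i\<in>{1..n} - {j}. z i t = z j t)"
      from Z.Q_add_reflect_pole[OF j this]
      have "- Z.Q (z j t) = cnj (Z.Q (circle_refl (z j t)))" by (simp add: neg_eq_iff_add_eq_0)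
      moreover have "star (P t) (z j t) + star (R t) (z j t) = cnj (Z.Q (circle_refl (z j t)))"
        using Z.star_poisson_cont_plus_R_pole[OF circle j] unfolding P_eq R_eq coef .
      moreover have "V t (z j t) = Z.Q (z j t)"
        unfolding V_def Z.Q_def coef ..
      ultimately show "log_time_deriv I (z j) t = star (P t) (z j t) + star (R t) (z j t)"
        using z_log'[OF j] by simp
    qed
    show "log_time_deriv I b t = of_nat (m - n + 1) * C t"
      using log[OF t b'(1)[OF t]] key[OF t] by simp
  qed
qed

end
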